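(* Let $b>0$, let $q:[-b,b]\to\mathbb{C}$ be continuous, and suppose there is a solution $f\in C^2[-b,b]$ of $f''-qf=0$ on $[-b,b]$ with $f(x)\ne0$ for all $x\in[-b,b]$ and $f(0)=1$. Let $\blacktriangle$ be the closed triangle with vertices $(\pm b,0)$ and $(0,b)$ in the $(x,t)$-plane. Consider the Cauchy problem $$u_{xx}-u_{tt}-q(x)u=0,\qquad u(x,0)=g(x),\quad u_t(x,0)=h(x)\quad(-b\le x\le b),$$ with $g\in C^2[-b,b]$ and $h\in C^1[-b,b]$. Suppose that $g$ and $h$ admit series expansions $$g(x)=\sum_{k=0}^{\infty}\alpha_k\varphi_k(x),\qquad h(x)=\sum_{k=0}^{\infty}\beta_k\varphi_k(x)$$ uniformly convergent on $[-b,b]$. Then the unique (classical) solution of the Cauchy problem in $\blacktriangle$ has the form $$u(x,t)=\sum_{n=0}^{\infty}a_nu_n(x,t),$$ where the series is uniformly convergent in $\blacktriangle$, and the coefficients are $a_0=\alpha_0$, $a_{2n-1}=\alpha_n$ for $n=1,2,\ldots$, and $a_{2(n+1)}=\frac{\beta_n}{n+1}$ for $n=0,1,2,\ldots$.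
   Context: Given $f$, define on $[-b,b]$ the functions $\widetilde X^{(0)}\equiv X^{(0)}\equiv1$ and, for $n\ge1$, $$\widetilde X^{(n)}(x)=n\int_0^x\widetilde X^{(n-1)}(s)\,(f^2(s))^{(-1)^{n-1}}ds,\qquad X^{(n)}(x)=n\int_0^xX^{(n-1)}(s)\,(f^2(s))^{(-1)^{n}}ds,$$ and set $\varphi_k=fX^{(k)}$ for $k$ odd and $\varphi_k=f\widetilde X^{(k)}$ for $k$ even. The generalized wave polynomials are $u_0(x,t)=f(x)$ and, for $m\ge1$, $$u_m(x,t)=\sum_{\text{even }k=0}^{(m+1)/2}\binom{\frac{m+1}{2}}{k}\varphi_{\frac{m+1}{2}-k}(x)\,t^k\ \ (m\text{ odd}),\qquad u_m(x,t)=\sum_{\text{odd }k=1}^{m/2}\binom{\frac m2}{k}\varphi_{\frac m2-k}(x)\,t^k\ \ (m\text{ even}).$$ For $q\in C[-b,b]$, $g\in C^2[-b,b]$, $h\in C^1[-b,b]$ the Cauchy problem is known to possess a unique classical solution in $\blacktriangle$. *)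

theory Defs
  imports "HOL-Analysis.Analysis"
begin

text \<open>\<open>LBINT s=0..x\<close> is the oriented integral, so \<open>x < 0\<close> is covered.  Although \<open>f\<close> is a
  total function, for \<open>x\<close> in \<open>[-b,b]\<close> only its values on \<open>[-b,b]\<close> matter.  The recursion is
  shifted: the step from \<open>n\<close> to \<open>Suc n\<close> carries the exponents \<open>(-1)^n\<close> and \<open>(-1)^(Suc n)\<close>.\<close>

primrec Xtilde :: "(real \<Rightarrow> complex) \<Rightarrow> nat \<Rightarrow> real \<Rightarrow> complex" where
  "Xtilde f 0 = (\<lambda>x. 1)"
| "Xtilde f (Suc n) =
    (\<lambda>x. of_nat (Suc n) * (LBINT s=0..x. Xtilde f n s * ((f s)\<^sup>2) powi ((-1) ^ n)))"

primrec Xplain :: "(real \<Rightarrow> complex) \<Rightarrow> nat \<Rightarrow> real \<Rightarrow> complex" where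
  "Xplain f 0 = (\<lambda>x. 1)"
| "Xplain f (Suc n) =
    (\<lambda>x. of_nat (Suc n) * (LBINT s=0..x. Xplain f n s * ((f s)\<^sup>2) powi ((-1) ^ Suc n)))"

definition phi :: "(real \<Rightarrow> complex) \<Rightarrow> nat \<Rightarrow> real \<Rightarrow> complex" where
  "phi f k x = (if odd k then f x * Xplain f k x else f x * Xtilde f k x)"

definition wave_poly :: "(real \<Rightarrow> complex) \<Rightarrow> nat \<Rightarrow> real \<times> real \<Rightarrow> complex" where
  "wave_poly f m = (\<lambda>(x, t).
    if m = 0 then f x
    else if odd m then
      (\<Sum>k | even k \<and> k \<le> (m + 1) div 2.
        of_nat ((m + 1) div 2 choose k) * phi f ((m + 1) div 2 - k) x * of_real t ^ k)
    else
      (\<Sum>k | odd k \<and> k \<le> m div 2.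
        of_nat (m div 2 choose k) * phi f (m div 2 - k) x * of_real t ^ k))"

text \<open>Derivatives at the end points of \<open>[-b,b]\<close> are one-sided, hence \<open>at x within S\<close>;
  the library's \<open>C1_differentiable_on\<close> would ask for two-sided ones.\<close>

definition C1_deriv :: "real set \<Rightarrow> (real \<Rightarrow> complex) \<Rightarrow> (real \<Rightarrow> complex) \<Rightarrow> bool" where
  "C1_deriv S f f' \<longleftrightarrow>
    continuous_on S f' \<and> (\<forall>x\<in>S. (f has_vector_derivative f' x) (at x within S))"

definition C1_on :: "real set \<Rightarrow> (real \<Rightarrow> complex) \<Rightarrow> bool" where
  "C1_on S f \<longleftrightarrow> (\<exists>f'. C1_deriv S f f')"

definition C2_on :: "real set \<Rightarrow> (real \<Rightarrow> complex) \<Rightarrow> bool" where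
  "C2_on S f \<longleftrightarrow> (\<exists>f' f''. C1_deriv S f f' \<and> C1_deriv S f' f'')"

definition C2_ode_solution :: "real set \<Rightarrow> (real \<Rightarrow> complex) \<Rightarrow> (real \<Rightarrow> complex) \<Rightarrow> bool" where
  "C2_ode_solution S q f \<longleftrightarrow>
    (\<exists>f' f''. C1_deriv S f f' \<and> C1_deriv S f' f'' \<and> (\<forall>x\<in>S. f'' x - q x * f x = 0))"

definition char_triangle :: "real \<Rightarrow> (real \<times> real) set" where
  "char_triangle b = convex hull {(-b, 0), (b, 0), (0, b)}"

text \<open>Total derivatives relative to \<open>S\<close>, not derivatives along the coordinate lines: at a
  vertex of the triangle a coordinate line may meet the triangle in that vertex only.  On the
  closed triangle with \<open>b > 0\<close> the functions \<open>ux\<close> and \<open>ut\<close> are determined by \<open>u\<close>.\<close>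

definition C1_partials ::
  "(real \<times> real) set \<Rightarrow> (real \<times> real \<Rightarrow> complex) \<Rightarrow> (real \<times> real \<Rightarrow> complex) \<Rightarrow>
    (real \<times> real \<Rightarrow> complex) \<Rightarrow> bool" where
  "C1_partials S u ux ut \<longleftrightarrow>
    continuous_on S ux \<and> continuous_on S ut \<and>
    (\<forall>p\<in>S. (u has_derivative (\<lambda>(dx, dt). dx *\<^sub>R ux p + dt *\<^sub>R ut p)) (at p within S))"

text \<open>A classical solution is twice continuously differentiable up to the boundary of the
  closed triangle.\<close>

definition classical_solution ::
  "real \<Rightarrow> (real \<Rightarrow> complex) \<Rightarrow> (real \<Rightarrow> complex) \<Rightarrow> (real \<Rightarrow> complex) \<Rightarrow>
    (real \<times> real \<Rightarrow> complex) \<Rightarrow> bool" where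
  "classical_solution b q g h u \<longleftrightarrow>
    (\<exists>ux ut uxx uxt utx utt.
      C1_partials (char_triangle b) u ux ut \<and>
      C1_partials (char_triangle b) ux uxx uxt \<and>
      C1_partials (char_triangle b) ut utx utt \<and>
      (\<forall>(x, t)\<in>char_triangle b. uxx (x, t) - utt (x, t) - q x * u (x, t) = 0) \<and>
      (\<forall>x\<in>{-b..b}. u (x, 0) = g x \<and> ut (x, 0) = h x))"

end

theory Submission
  imports Defs
begin

text \<open>The Cauchy problem is traded for the integral equation
  \<open>u = dalembert g h - duhamel (qu)\<close>, whose continuous solutions on the triangle are called mild
  solutions here.  As it contains no derivatives it is stable under uniform limits, and a Gronwall
  estimate (\<open>mild_solution_bound\<close>) controls a mild solution by the suprema of \<open>g\<close> and \<open>h\<close>.  So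
  uniform convergence of the data forces uniform convergence of the mild solutions
  (\<open>mild_solutions_converge\<close>), and mild solutions are unique.

  The series fits into this picture because each \<open>u\<^sub>m\<close> solves the equation.  Indeed
  \<open>\<phi>\<^sub>k'' - q \<phi>\<^sub>k = k(k-1) \<phi>\<^sub>k\<^sub>-\<^sub>2\<close> (\<open>phi_C2\<close>), which is what makes the even and odd parts of
  \<open>(x + t)\<^sup>n\<close> solutions of the wave equation when \<open>f = 1\<close>.  The polynomial with index \<open>2n - 1\<close> has
  the Cauchy data \<open>(\<phi>\<^sub>n, 0)\<close>, that with index \<open>2(n + 1)\<close> the data \<open>(0, (n + 1) \<phi>\<^sub>n)\<close>.  Hence a
  partial sum of the series is the mild solution whose data are partial sums of the expansions of
  \<open>g\<close> and \<open>h\<close> (\<open>mild_solution_partial_sum\<close>), and these converge uniformly by assumption.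

  It remains to pass between mild and classical solutions.  A classical solution is mild by
  integration over the backward characteristic triangle (\<open>classical_imp_mild_solution\<close>).
  Conversely, for \<open>g\<close> of class \<open>C\<^sup>2\<close> and \<open>h\<close> of class \<open>C\<^sup>1\<close> a mild solution is classical
  (\<open>mild_solution_imp_classical\<close>): the Duhamel integral of \<open>F\<close> is \<open>C\<^sup>1\<close> if \<open>F\<close> is continuous, and
  \<open>C\<^sup>2\<close> if \<open>F\<close> is in addition continuously differentiable in \<open>t\<close>.  The latter holds for
  \<open>F(x,t) = q(x) u(x,t)\<close> once \<open>u\<close> is \<open>C\<^sup>1\<close>, however rough the continuous function \<open>q\<close> is.\<close>

section \<open>Oriented integrals and extension from an interval\<close>

text \<open>The integral of \<open>w\<close> from \<open>0\<close> to \<open>a\<close>, oriented, pulled back to the unit interval.  In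
  this form the upper limit is a parameter like any other, so that the theorems on parameter
  integrals over a fixed interval also give continuity and differentiability jointly in the upper
  limit and in further parameters.\<close>

definition prim :: "(real \<Rightarrow> 'a) \<Rightarrow> real \<Rightarrow> 'a::euclidean_space" where
  "prim w a = a *\<^sub>R integral {0..1} (\<lambda>r. w (a * r))"

lemma prim_zero [simp]: "prim w 0 = 0"
  by (simp add: prim_def)

lemma has_vector_derivative_affine:
  "((\<lambda>r. c + a * r) has_vector_derivative (a::real)) (at r within S)"
  unfolding has_real_derivative_iff_has_vector_derivative[symmetric]
  by (auto intro!: derivative_eq_intros)

lemma has_vector_derivative_compose_affine:
  assumes "(G has_vector_derivative w) (at (c + a * r) within T)" "\<And>s. s \<in> S \<Longrightarrow> c + a * s \<in> T"
  shows "((\<lambda>s. G (c + a * s)) has_vector_derivative a *\<^sub>R w) (at r within S)"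
proof -
  have "(G has_vector_derivative w) (at (c + a * r) within (\<lambda>s. c + a * s) ` S)"
    using assms(2) by (intro has_vector_derivative_within_subset[OF assms(1)]) auto
  from vector_diff_chain_within[OF has_vector_derivative_affine this] show ?thesis
    by (simp add: o_def)
qed

lemma prim_eq_antiderivative_diff:
  assumes "\<And>x. (G has_vector_derivative w x) (at x)"
  shows "prim w a = G a - G 0"
proof -
  have "((\<lambda>r. G (a * r)) has_vector_derivative a *\<^sub>R w (a * r)) (at r within {0..1})" for r
    using has_vector_derivative_compose_affine[of G "w (a * r)" 0 a r UNIV "{0..1}"] assms by simp
  then have "((\<lambda>r. a *\<^sub>R w (a * r)) has_integral (G (a * 1) - G (a * 0))) {0..1}"
    by (intro fundamental_theorem_of_calculus) auto
  then show ?thesis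
    by (simp add: prim_def integral_unique flip: integral_cmul)
qed

lemma antiderivative_exists:
  fixes w :: "real \<Rightarrow> 'a::euclidean_space"
  assumes "continuous_on UNIV w"
  obtains G where "\<And>x. (G has_vector_derivative w x) (at x)"
proof -
  have "\<exists>G. \<forall>x::real. -\<infinity> < ereal x \<longrightarrow> ereal x < \<infinity> \<longrightarrow> (G has_vector_derivative w x) (at x)"
    using assms by (intro einterval_antiderivative) (auto simp: continuous_on_eq_continuous_at)
  then show ?thesis
    using that by auto
qed

lemma prim_has_vector_derivative:
  assumes "continuous_on UNIV w"
  shows "(prim w has_vector_derivative w a) (at a)"
proof -
  obtain G where G: "\<And>x. (G has_vector_derivative w x) (at x)"
    using antiderivative_exists[OF assms] by blast
  have "prim w = (\<lambda>a. G a - G 0)"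
    using prim_eq_antiderivative_diff[OF G] by auto
  then show ?thesis
    using has_vector_derivative_diff[OF G has_vector_derivative_const] by simp
qed

lemma prim_diff:
  assumes "continuous_on UNIV w" "a \<le> c"
  shows "prim w c - prim w a = integral {a..c} w"
  by (rule integral_unique[symmetric], rule fundamental_theorem_of_calculus)
    (auto intro!: has_vector_derivative_at_within prim_has_vector_derivative assms)

lemma prim_affine:
  fixes w :: "real \<Rightarrow> 'a::euclidean_space"
  assumes "continuous_on UNIV w" "\<sigma> \<noteq> 0"
  shows "prim (\<lambda>s. w (c + \<sigma> * s)) a = (prim w (c + \<sigma> * a) - prim w c) /\<^sub>R \<sigma>"
proof -
  have "((\<lambda>s. prim w (c + \<sigma> * s) /\<^sub>R \<sigma>) has_vector_derivative w (c + \<sigma> * s)) (at s)" for s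
  proof -
    have "((\<lambda>s. prim w (c + \<sigma> * s)) has_vector_derivative \<sigma> *\<^sub>R w (c + \<sigma> * s)) (at s)"
      using has_vector_derivative_compose_affine[OF prim_has_vector_derivative[OF assms(1)]] by simp
    then have "((\<lambda>s. prim w (c + \<sigma> * s) /\<^sub>R \<sigma>) has_vector_derivative (\<sigma> *\<^sub>R w (c + \<sigma> * s)) /\<^sub>R \<sigma>) (at s)"
      using bounded_linear.has_vector_derivative[OF bounded_linear_scaleR_right] by blast
    then show ?thesis using assms by simp
  qed
  from prim_eq_antiderivative_diff[OF this] show ?thesis
    by (simp add: scaleR_diff_right)
qed

text \<open>Shifts and scalings of the interval are moved into the integrand; the horizontal slices of
  a characteristic triangle are treated this way, because their end points move with the height.\<close>

lemma integral_centred_interval: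
  fixes w :: "real \<Rightarrow> 'a::euclidean_space"
  assumes "continuous_on {c-\<tau>..c+\<tau>} w" "\<tau> \<ge> 0"
  shows "\<tau> *\<^sub>R integral {-1..1} (\<lambda>r. w (c + \<tau> * r)) = integral {c-\<tau>..c+\<tau>} w"
proof -
  define G where "G = (\<lambda>x. integral {c-\<tau>..x} w)"
  have G: "(G has_vector_derivative w x) (at x within {c-\<tau>..c+\<tau>})" if "x \<in> {c-\<tau>..c+\<tau>}" for x
    unfolding G_def using integral_has_vector_derivative[OF assms(1) that] .
  have r: "(\<lambda>r. c + \<tau> * r) ` {-1..1} \<subseteq> {c-\<tau>..c+\<tau>}"
  proof (rule image_subsetI)
    fix r :: real assume "r \<in> {-1..1}"
    then show "c + \<tau> * r \<in> {c-\<tau>..c+\<tau>}"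
      using mult_left_mono[OF _ assms(2), of "-1" r] mult_left_mono[OF _ assms(2), of r 1] by auto
  qed
  have "((\<lambda>r. G (c + \<tau> * r)) has_vector_derivative \<tau> *\<^sub>R w (c + \<tau> * r)) (at r within {-1..1})"
    if "r \<in> {-1..1}" for r
  proof (rule has_vector_derivative_compose_affine)
    show "(G has_vector_derivative w (c + \<tau> * r)) (at (c + \<tau> * r) within {c-\<tau>..c+\<tau>})"
      using r that by (intro G) blast
    show "c + \<tau> * s \<in> {c-\<tau>..c+\<tau>}" if "s \<in> {-1..1}" for s
      using r that by blast
  qed
  then have "((\<lambda>r. \<tau> *\<^sub>R w (c + \<tau> * r)) has_integral (G (c + \<tau> * 1) - G (c + \<tau> * (-1)))) {-1..1}"
    by (intro fundamental_theorem_of_calculus) auto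
  moreover have "G (c - \<tau>) = 0"
    by (simp add: G_def)
  ultimately show ?thesis
    by (simp add: integral_unique G_def flip: integral_cmul)
qed

lemma continuous_extension_interval:
  fixes w :: "real \<Rightarrow> 'a::euclidean_space"
  assumes "continuous_on {a..b} w" "a \<le> b"
  obtains W where "continuous_on UNIV W" "\<And>x. x \<in> {a..b} \<Longrightarrow> W x = w x"
proof
  show "continuous_on UNIV (ext_cont w a b)"
    using assms by (intro continuous_on_ext_cont) auto
  show "ext_cont w a b x = w x" if "x \<in> {a..b}" for x
    using that by simp
qed

text \<open>A \<open>C\<^sup>k\<close> function on an interval is extended to the line from its highest derivative
  downwards: any continuous extension of the derivative is integrated, with the constant that
  fits at one end point.\<close>

lemma C1_deriv_extension:
  assumes w: "C1_deriv {a..b} w w'"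
    and w': "continuous_on UNIV W'" "\<And>x. x \<in> {a..b} \<Longrightarrow> W' x = w' x" and "a \<le> b"
  obtains W where "C1_deriv UNIV W W'" "\<And>x. x \<in> {a..b} \<Longrightarrow> W x = w x"
proof -
  obtain G where G: "\<And>x. (G has_vector_derivative W' x) (at x)"
    using antiderivative_exists[OF w'(1)] by blast
  define W where "W = (\<lambda>x. w a + (G x - G a))"
  have W: "(W has_vector_derivative W' x) (at x)" for x
    using has_vector_derivative_add[OF has_vector_derivative_const has_vector_derivative_diff[OF G has_vector_derivative_const]]
    by (simp add: W_def)
  have "W x = w x" if x: "x \<in> {a..b}" for x
  proof -
    have "((\<lambda>x. w x - W x) has_vector_derivative 0) (at x within {a..b})" if "x \<in> {a..b}" for x
    proof -
      have "(W has_vector_derivative w' x) (at x within {a..b})"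
        using has_vector_derivative_at_within[OF W, of x "{a..b}"] w'(2)[OF that] by simp
      moreover have "(w has_vector_derivative w' x) (at x within {a..b})"
        using w that by (auto simp: C1_deriv_def)
      ultimately show ?thesis
        using has_vector_derivative_diff by force
    qed
    then obtain c where "\<And>x. x \<in> {a..b} \<Longrightarrow> w x - W x = c"
      using has_vector_derivative_zero_constant[of "{a..b}" "\<lambda>x. w x - W x"] by auto
    from this[of x] this[of a] x \<open>a \<le> b\<close> show ?thesis
      by (simp add: W_def)
  qed
  moreover have "C1_deriv UNIV W W'"
    using w'(1) W by (auto simp: C1_deriv_def)
  ultimately show ?thesis
    using that by blast
qed

section \<open>Continuously differentiable functions of two variables\<close>

lemma C1_partials_continuous:
  assumes "C1_partials S u ux ut"
  shows "continuous_on S u"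
  using assms unfolding C1_partials_def continuous_on_eq_continuous_within
  by (meson has_derivative_continuous)

lemma C1_partials_subset:
  assumes "C1_partials S u ux ut" "T \<subseteq> S"
  shows "C1_partials T u ux ut"
  unfolding C1_partials_def
proof (intro conjI ballI)
  fix p assume "p \<in> T"
  then show "(u has_derivative (\<lambda>(dx, dt). dx *\<^sub>R ux p + dt *\<^sub>R ut p)) (at p within T)"
    using assms unfolding C1_partials_def by (intro has_derivative_subset[OF _ assms(2)]) auto
qed (use assms in \<open>auto simp: C1_partials_def intro: continuous_on_subset\<close>)

lemma C1_partials_cong:
  assumes "C1_partials S u ux ut" "\<And>p. p \<in> S \<Longrightarrow> ux' p = ux p" "\<And>p. p \<in> S \<Longrightarrow> ut' p = ut p"
  shows "C1_partials S u ux' ut'"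
proof -
  have "continuous_on S ux'" "continuous_on S ut'"
    using assms continuous_on_cong[of S S ux' ux] continuous_on_cong[of S S ut' ut]
    by (auto simp: C1_partials_def)
  then show ?thesis
    using assms unfolding C1_partials_def by simp
qed

lemma C1_partials_zero: "C1_partials S (\<lambda>p. 0) (\<lambda>p. 0) (\<lambda>p. 0)"
  by (simp add: C1_partials_def case_prod_unfold)

lemma C1_partials_add:
  assumes "C1_partials S u ux ut" "C1_partials S v vx vt"
  shows "C1_partials S (\<lambda>p. u p + v p) (\<lambda>p. ux p + vx p) (\<lambda>p. ut p + vt p)"
  unfolding C1_partials_def
proof (intro conjI ballI)
  fix p assume "p \<in> S"
  then have "((\<lambda>p. u p + v p) has_derivative (\<lambda>d. (\<lambda>(dx, dt). dx *\<^sub>R ux p + dt *\<^sub>R ut p) d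
      + (\<lambda>(dx, dt). dx *\<^sub>R vx p + dt *\<^sub>R vt p) d)) (at p within S)"
    using assms unfolding C1_partials_def by (intro has_derivative_add) auto
  then show "((\<lambda>p. u p + v p) has_derivative
      (\<lambda>(dx, dt). dx *\<^sub>R (ux p + vx p) + dt *\<^sub>R (ut p + vt p))) (at p within S)"
    by (rule has_derivative_eq_rhs) (auto simp: algebra_simps)
qed (use assms in \<open>auto simp: C1_partials_def intro!: continuous_intros\<close>)

lemma C1_partials_cmult:
  assumes "C1_partials S u ux ut"
  shows "C1_partials S (\<lambda>p. c * u p) (\<lambda>p. c * ux p) (\<lambda>p. c * ut p)"
  unfolding C1_partials_def
proof (intro conjI ballI)
  fix p assume "p \<in> S"
  then have "((\<lambda>p. c * u p) has_derivative (\<lambda>d. c * (\<lambda>(dx, dt). dx *\<^sub>R ux p + dt *\<^sub>R ut p) d)) (at p within S)"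
    using assms unfolding C1_partials_def by (intro has_derivative_mult_right) auto
  then show "((\<lambda>p. c * u p) has_derivative
      (\<lambda>(dx, dt). dx *\<^sub>R (c * ux p) + dt *\<^sub>R (c * ut p))) (at p within S)"
    by (rule has_derivative_eq_rhs) (auto simp: algebra_simps)
qed (use assms in \<open>auto simp: C1_partials_def intro!: continuous_intros\<close>)

lemma C1_partials_diff:
  assumes "C1_partials S u ux ut" "C1_partials S v vx vt"
  shows "C1_partials S (\<lambda>p. u p - v p) (\<lambda>p. ux p - vx p) (\<lambda>p. ut p - vt p)"
  using C1_partials_add[OF assms(1) C1_partials_cmult[OF assms(2), of "-1"]] by simp

lemma C1_partials_sum:
  assumes "\<And>k. k \<in> K \<Longrightarrow> C1_partials S (u k) (ux k) (ut k)"
  shows "C1_partials S (\<lambda>p. \<Sum>k\<in>K. u k p) (\<lambda>p. \<Sum>k\<in>K. ux k p) (\<lambda>p. \<Sum>k\<in>K. ut k p)"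
  using assms by (induction K rule: infinite_finite_induct)
    (auto intro: C1_partials_zero C1_partials_add)

lemma C1_partials_along_line:
  assumes "C1_partials S u ux ut" "s \<in> I" "\<And>s. s \<in> I \<Longrightarrow> (x + a * s, t + c * s) \<in> S"
  shows "((\<lambda>s. u (x + a * s, t + c * s)) has_vector_derivative
    a *\<^sub>R ux (x + a * s, t + c * s) + c *\<^sub>R ut (x + a * s, t + c * s)) (at s within I)"
proof -
  let ?p = "\<lambda>s. (x + a * s, t + c * s)"
  have "(?p has_derivative (\<lambda>d. (a * d, c * d))) (at s within I)"
    by (auto intro!: derivative_eq_intros)
  moreover have "(u has_derivative (\<lambda>(dx, dt). dx *\<^sub>R ux (?p s) + dt *\<^sub>R ut (?p s))) (at (?p s) within ?p ` I)"
  proof (rule has_derivative_subset)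
    show "(u has_derivative (\<lambda>(dx, dt). dx *\<^sub>R ux (?p s) + dt *\<^sub>R ut (?p s))) (at (?p s) within S)"
      using assms(1) assms(3)[OF assms(2)] unfolding C1_partials_def by blast
    show "?p ` I \<subseteq> S"
      using assms(3) by blast
  qed
  ultimately have "((u \<circ> ?p) has_derivative
      ((\<lambda>(dx, dt). dx *\<^sub>R ux (?p s) + dt *\<^sub>R ut (?p s)) \<circ> (\<lambda>d. (a * d, c * d)))) (at s within I)"
    by (rule diff_chain_within)
  then show ?thesis
    unfolding has_vector_derivative_def o_def
    by (rule has_derivative_eq_rhs) (auto simp: algebra_simps)
qed

lemma C1_partials_compose_linear:
  assumes "C1_partials UNIV u u1 u2"
  shows "C1_partials UNIV (\<lambda>(x, t). u (a * x + c * t, d * x + e * t))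
    (\<lambda>(x, t). a *\<^sub>R u1 (a * x + c * t, d * x + e * t) + d *\<^sub>R u2 (a * x + c * t, d * x + e * t))
    (\<lambda>(x, t). c *\<^sub>R u1 (a * x + c * t, d * x + e * t) + e *\<^sub>R u2 (a * x + c * t, d * x + e * t))"
proof -
  define L where "L = (\<lambda>p::real \<times> real. (a * fst p + c * snd p, d * fst p + e * snd p))"
  have cont: "continuous_on UNIV (\<lambda>p. w (L p))" if "continuous_on UNIV w" for w :: "real \<times> real \<Rightarrow> complex"
    by (rule continuous_on_compose2[OF that]) (auto simp: L_def intro!: continuous_intros)
  have "((u \<circ> L) has_derivative (\<lambda>(dx, dt). dx *\<^sub>R (a *\<^sub>R u1 (L p) + d *\<^sub>R u2 (L p))
      + dt *\<^sub>R (c *\<^sub>R u1 (L p) + e *\<^sub>R u2 (L p)))) (at p)" for p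
  proof -
    have "(L has_derivative L) (at p)"
      unfolding L_def by (auto intro!: derivative_eq_intros)
    moreover have "(u has_derivative (\<lambda>(dx, dt). dx *\<^sub>R u1 (L p) + dt *\<^sub>R u2 (L p))) (at (L p))"
      using assms by (simp add: C1_partials_def del: split_paired_All)
    ultimately have "((u \<circ> L) has_derivative ((\<lambda>(dx, dt). dx *\<^sub>R u1 (L p) + dt *\<^sub>R u2 (L p)) \<circ> L)) (at p)"
      by (rule diff_chain_at)
    then show ?thesis
      by (rule has_derivative_eq_rhs) (auto simp: L_def o_def algebra_simps)
  qed
  then have "C1_partials UNIV (\<lambda>p. u (L p)) (\<lambda>p. a *\<^sub>R u1 (L p) + d *\<^sub>R u2 (L p))
      (\<lambda>p. c *\<^sub>R u1 (L p) + e *\<^sub>R u2 (L p))"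
    using assms unfolding C1_partials_def o_def
    by (intro conjI ballI continuous_on_add continuous_on_scaleR continuous_on_const cont) auto
  then show ?thesis
    by (simp add: L_def case_prod_unfold)
qed

lemma C1_partials_UNIV_I:
  assumes x: "\<And>x t. ((\<lambda>x. u (x, t)) has_vector_derivative ux (x, t)) (at x)"
    and t: "\<And>x t. ((\<lambda>t. u (x, t)) has_vector_derivative ut (x, t)) (at t)"
    and "continuous_on UNIV ux" "continuous_on UNIV ut"
  shows "C1_partials UNIV u ux ut"
proof -
  have "(u has_derivative (\<lambda>(dx, dt). dx *\<^sub>R ux (x, t) + dt *\<^sub>R ut (x, t))) (at (x, t))" for x t
  proof -
    have "((\<lambda>(x, t). u (x, t)) has_derivative (\<lambda>(dx, dt). dx *\<^sub>R ux (x, t)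
        + blinfun_scaleR_left (ut (x, t)) dt)) (at (x, t) within UNIV \<times> UNIV)"
    proof (rule has_derivative_partialsI)
      show "((\<lambda>x. u (x, t)) has_derivative (\<lambda>dx. dx *\<^sub>R ux (x, t))) (at x within UNIV)"
        using x[of t x] by (simp add: has_vector_derivative_def)
      show "((\<lambda>y. u (x, y)) has_derivative blinfun_apply (blinfun_scaleR_left (ut (x, y)))) (at y within UNIV)" for x y
        using t[of x y] by (simp add: has_vector_derivative_def)
      have "continuous (at (x, t)) ut"
        using assms(4) by (simp add: continuous_on_eq_continuous_at)
      then show "continuous (at (x, t) within UNIV \<times> UNIV) (\<lambda>(x, y). blinfun_scaleR_left (ut (x, y)))"
        by (auto simp: case_prod_unfold intro!: continuous_intros)
    qed auto
    then show ?thesis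
      by simp
  qed
  then show ?thesis
    using assms by (auto simp: C1_partials_def)
qed

lemma continuous_on_prim:
  assumes "continuous_on UNIV (\<lambda>(y, z). k y z)"
  shows "continuous_on UNIV (\<lambda>(a, z::'a::topological_space). prim (\<lambda>y. k y z :: complex) a)"
proof -
  have "continuous_on UNIV (\<lambda>p. integral (cbox 0 1) (\<lambda>r. k (fst p * r) (snd p :: 'a)))"
  proof (rule integral_continuous_on_param)
    show "continuous_on (UNIV \<times> cbox 0 1) (\<lambda>(p, r). k (fst p * r) (snd p))"
      unfolding case_prod_unfold
      by (rule continuous_on_compose2[OF assms, of _ "\<lambda>q. (fst (fst q) * snd q, snd (fst q))", simplified])
        (auto intro!: continuous_intros)
  qed
  then show ?thesis
    by (auto simp: case_prod_unfold prim_def intro!: continuous_intros)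
qed

text \<open>Differentiation under the integral sign, combined with the fundamental theorem for the moving
  upper limit.  All \<open>C\<^sup>1\<close> properties of the integrals below are obtained from this lemma by a
  linear change of variables.\<close>

lemma C1_partials_prim:
  assumes k: "continuous_on UNIV (\<lambda>(y, z). k y z)" "continuous_on UNIV (\<lambda>(y, z). k' y z)"
    and k': "\<And>y z. ((\<lambda>z. k y z) has_vector_derivative k' y z) (at z)"
  shows "C1_partials UNIV (\<lambda>(a, z). prim (\<lambda>y. k y z) a) (\<lambda>(a, z). k a z)
    (\<lambda>(a, z). prim (\<lambda>y. k' y z) a)"
proof (rule C1_partials_UNIV_I)
  have slice: "continuous_on S (\<lambda>r. k (a * r) z)" for S a z
    by (rule continuous_on_compose2[OF k(1), of _ "\<lambda>r. (a * r, z)", simplified])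
      (auto intro!: continuous_intros)
  fix a z :: real
  show "((\<lambda>a. case (a, z) of (a, z) \<Rightarrow> prim (\<lambda>y. k y z) a) has_vector_derivative
      (case (a, z) of (a, z) \<Rightarrow> k a z)) (at a)"
    using prim_has_vector_derivative[OF slice[of UNIV 1 z]] by simp
  have "((\<lambda>z. integral (cbox 0 1) (\<lambda>r. k (a * r) z)) has_vector_derivative
      integral (cbox 0 1) (\<lambda>r. k' (a * r) z)) (at z within UNIV)"
  proof (rule leibniz_rule_vector_derivative)
    show "continuous_on (UNIV \<times> cbox 0 1) (\<lambda>(z, r). k' (a * r) z)"
      unfolding case_prod_unfold
      by (rule continuous_on_compose2[OF k(2), of _ "\<lambda>q. (a * snd q, fst q)", simplified])
        (auto intro!: continuous_intros)
    show "(\<lambda>r. k (a * r) z) integrable_on cbox 0 1" for z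
      by (intro integrable_continuous slice)
  qed (use k' in auto)
  then show "((\<lambda>z. case (a, z) of (a, z) \<Rightarrow> prim (\<lambda>y. k y z) a) has_vector_derivative
      (case (a, z) of (a, z) \<Rightarrow> prim (\<lambda>y. k' y z) a)) (at z)"
    using bounded_linear.has_vector_derivative[OF bounded_linear_scaleR_right]
    by (simp add: prim_def)
qed (use k continuous_on_prim[OF k(2)] in auto)

section \<open>Mild solutions on the characteristic triangle\<close>

lemma mem_char_triangle:
  assumes "b > 0"
  shows "(x, t) \<in> char_triangle b \<longleftrightarrow> 0 \<le> t \<and> \<bar>x\<bar> + t \<le> b"
proof
  assume "(x, t) \<in> char_triangle b"
  then obtain \<kappa> \<mu> \<nu> where "0 \<le> \<kappa>" "0 \<le> \<mu>" "0 \<le> \<nu>" "\<kappa> + \<mu> + \<nu> = 1"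
    and x: "x = \<mu> * b - \<kappa> * b" and t: "t = \<nu> * b"
    unfolding char_triangle_def convex_hull_3 by auto
  then have "b = \<kappa> * b + \<mu> * b + \<nu> * b"
    by (simp flip: distrib_right)
  moreover have "0 \<le> \<kappa> * b" "0 \<le> \<mu> * b" "0 \<le> \<nu> * b"
    using assms \<open>0 \<le> \<kappa>\<close> \<open>0 \<le> \<mu>\<close> \<open>0 \<le> \<nu>\<close> by simp_all
  ultimately show "0 \<le> t \<and> \<bar>x\<bar> + t \<le> b"
    using x t by linarith
next
  assume *: "0 \<le> t \<and> \<bar>x\<bar> + t \<le> b"
  show "(x, t) \<in> char_triangle b"
    unfolding char_triangle_def convex_hull_3
    using assms *
    by (intro CollectI exI[of _ "(b - t - x) / (2 * b)"] exI[of _ "(b - t + x) / (2 * b)"] exI[of _ "t / b"])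
      (auto simp: field_simps)
qed

lemma fst_char_triangle: "b > 0 \<Longrightarrow> (x, t) \<in> char_triangle b \<Longrightarrow> x \<in> {-b..b}"
  by (auto simp: mem_char_triangle)

lemma compact_char_triangle: "compact (char_triangle b)"
  unfolding char_triangle_def by (intro finite_imp_compact_convex_hull) auto

lemma cone_subset_char_triangle:
  assumes "b > 0" "(x, t) \<in> char_triangle b" "0 \<le> s" "s \<le> t" "y \<in> {x-(t-s)..x+(t-s)}"
  shows "(y, s) \<in> char_triangle b"
  using assms by (auto simp: mem_char_triangle)

lemma cone_subset_char_triangle':
  assumes "b > 0" "(x, t) \<in> char_triangle b" "s \<in> {0..t}" "r \<in> {-1..1}"
  shows "(x + (t - s) * r, s) \<in> char_triangle b"
proof -
  have "(t - s) * r \<le> (t - s) * 1" "(t - s) * (-1) \<le> (t - s) * r"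
    using assms by (intro mult_left_mono; simp)+
  then have "x + (t - s) * r \<in> {x-(t-s)..x+(t-s)}"
    by simp
  then show ?thesis
    using assms(3) by (intro cone_subset_char_triangle[OF assms(1,2)]) auto
qed

definition dalembert :: "(real \<Rightarrow> complex) \<Rightarrow> (real \<Rightarrow> complex) \<Rightarrow> real \<times> real \<Rightarrow> complex" where
  "dalembert g h = (\<lambda>(x, t). (g (x + t) + g (x - t)) / 2 + integral {x-t..x+t} h / 2)"

text \<open>Half the integral of \<open>F\<close> over the backward characteristic triangle with apex \<open>(x,t)\<close>: by
  Duhamel's principle, the solution of \<open>u\<^sub>t\<^sub>t - u\<^sub>x\<^sub>x = F\<close> with zero Cauchy data.\<close>

definition duhamel :: "(real \<times> real \<Rightarrow> complex) \<Rightarrow> real \<times> real \<Rightarrow> complex" where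
  "duhamel F = (\<lambda>(x, t). integral {0..t} (\<lambda>s. integral {x-(t-s)..x+(t-s)} (\<lambda>y. F (y, s))) / 2)"

text \<open>Continuity of \<open>h\<close> belongs to the notion because the integral of \<open>h\<close> would otherwise not be
  additive; continuity of \<open>g\<close> follows from \<open>u(x,0) = g(x)\<close>.\<close>

definition mild_solution ::
  "real \<Rightarrow> (real \<Rightarrow> complex) \<Rightarrow> (real \<Rightarrow> complex) \<Rightarrow> (real \<Rightarrow> complex) \<Rightarrow>
    (real \<times> real \<Rightarrow> complex) \<Rightarrow> bool" where
  "mild_solution b q g h u \<longleftrightarrow>
    continuous_on {-b..b} h \<and> continuous_on (char_triangle b) u \<and>
    (\<forall>p\<in>char_triangle b. u p = dalembert g h p - duhamel (\<lambda>(y, s). q y * u (y, s)) p)"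

lemma continuous_on_potential_times:
  assumes "b > 0" "continuous_on {-b..b} q" "continuous_on (char_triangle b) u"
  shows "continuous_on (char_triangle b) (\<lambda>(y, s). q y * u (y, s) :: complex)"
proof -
  have "fst ` char_triangle b \<subseteq> {-b..b}"
    using assms by (auto simp: mem_char_triangle)
  then show ?thesis
    unfolding case_prod_unfold using assms
    by (auto intro!: continuous_intros continuous_on_compose2[OF assms(2)])
qed

lemma continuous_on_horizontal_slice:
  assumes "b > 0" "continuous_on (char_triangle b) F" "(x, t) \<in> char_triangle b" "s \<in> {0..t}"
  shows "continuous_on {x-(t-s)..x+(t-s)} (\<lambda>y. F (y, s) :: complex)"
proof (rule continuous_on_compose2[OF assms(2)])
  show "(\<lambda>y. (y, s)) ` {x-(t-s)..x+(t-s)} \<subseteq> char_triangle b"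
    using cone_subset_char_triangle[OF assms(1,3)] assms(4) by auto
qed (intro continuous_intros)

lemma continuous_on_cone_integral:
  assumes "b > 0" "continuous_on (char_triangle b) F" "(x, t) \<in> char_triangle b"
  shows "continuous_on {0..t} (\<lambda>s. integral {x-(t-s)..x+(t-s)} (\<lambda>y. F (y, s) :: complex))"
proof -
  have "continuous_on {0..t} (\<lambda>s. integral (cbox (-1) 1) (\<lambda>r. F (x + (t - s) * r, s)))"
  proof (rule integral_continuous_on_param)
    show "continuous_on ({0..t} \<times> cbox (-1) 1) (\<lambda>(s, r). F (x + (t - s) * r, s))"
      unfolding case_prod_unfold
    proof (rule continuous_on_compose2[OF assms(2)])
      show "continuous_on ({0..t} \<times> cbox (-1) 1) (\<lambda>p. (x + (t - fst p) * snd p, fst p))"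
        by (intro continuous_intros)
      show "(\<lambda>p. (x + (t - fst p) * snd p, fst p)) ` ({0..t} \<times> cbox (-1) 1) \<subseteq> char_triangle b"
        using cone_subset_char_triangle'[OF assms(1,3)] by auto
    qed
  qed
  then have "continuous_on {0..t} (\<lambda>s. (t - s) *\<^sub>R integral {-1..1} (\<lambda>r. F (x + (t - s) * r, s)))"
    by (auto intro!: continuous_intros)
  then show ?thesis
  proof (rule continuous_on_eq)
    fix s assume "s \<in> {0..t}"
    then show "(t - s) *\<^sub>R integral {-1..1} (\<lambda>r. F (x + (t - s) * r, s)) =
        integral {x-(t-s)..x+(t-s)} (\<lambda>y. F (y, s))"
      using integral_centred_interval[OF continuous_on_horizontal_slice[OF assms]] by auto
  qed
qed

lemma duhamel_add:
  assumes "b > 0" "continuous_on (char_triangle b) F" "continuous_on (char_triangle b) G"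
    and p: "p \<in> char_triangle b"
  shows "duhamel (\<lambda>p. F p + G p) p = duhamel F p + duhamel G p"
proof -
  obtain x t where [simp]: "p = (x, t)" by (cases p)
  have "integral {x-(t-s)..x+(t-s)} (\<lambda>y. F (y, s) + G (y, s)) =
      integral {x-(t-s)..x+(t-s)} (\<lambda>y. F (y, s)) + integral {x-(t-s)..x+(t-s)} (\<lambda>y. G (y, s))"
    if "s \<in> {0..t}" for s
    using assms(1) p that by (intro integral_add integrable_continuous_interval
        continuous_on_horizontal_slice[OF _ assms(2)] continuous_on_horizontal_slice[OF _ assms(3)]) auto
  then have "integral {0..t} (\<lambda>s. integral {x-(t-s)..x+(t-s)} (\<lambda>y. F (y, s) + G (y, s))) =
      integral {0..t} (\<lambda>s. integral {x-(t-s)..x+(t-s)} (\<lambda>y. F (y, s)) + integral {x-(t-s)..x+(t-s)} (\<lambda>y. G (y, s)))"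
    by (intro integral_cong) auto
  also have "\<dots> = integral {0..t} (\<lambda>s. integral {x-(t-s)..x+(t-s)} (\<lambda>y. F (y, s))) +
      integral {0..t} (\<lambda>s. integral {x-(t-s)..x+(t-s)} (\<lambda>y. G (y, s)))"
    using assms(1) p by (intro integral_add integrable_continuous_interval
        continuous_on_cone_integral[OF _ assms(2)] continuous_on_cone_integral[OF _ assms(3)]) auto
  finally show ?thesis
    by (simp add: duhamel_def add_divide_distrib)
qed

lemma duhamel_cmult: "duhamel (\<lambda>p. c * F p) p = c * duhamel F p"
  by (cases p) (simp add: duhamel_def)

text \<open>Integrating the weight \<open>exp(\<kappa>s)\<close> in time gains the factor \<open>1/\<kappa>\<close>.  For large \<open>\<kappa>\<close> the
  Duhamel term is therefore a small perturbation in the weighted norm, on a triangle of any size.\<close>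

lemma norm_duhamel_le:
  assumes "b > 0" "continuous_on (char_triangle b) F" "(x, t) \<in> char_triangle b" "\<kappa> > 0" "B \<ge> 0"
    and F: "\<And>y s. (y, s) \<in> char_triangle b \<Longrightarrow> norm (F (y, s)) \<le> B * exp (\<kappa> * s)"
  shows "norm (duhamel F (x, t)) \<le> b * B / \<kappa> * exp (\<kappa> * t)"
proof -
  have t: "0 \<le> t" "t \<le> b"
    using assms by (auto simp: mem_char_triangle)
  let ?E = "\<lambda>s. 2 * b * B * exp (\<kappa> * s)"
  have "((\<lambda>s. 2 * b * B / \<kappa> * exp (\<kappa> * s)) has_vector_derivative ?E s) (at s within {0..t})" for s
    unfolding has_real_derivative_iff_has_vector_derivative[symmetric]
    using assms by (auto intro!: derivative_eq_intros)
  then have E: "(?E has_integral (2 * b * B / \<kappa> * exp (\<kappa> * t) - 2 * b * B / \<kappa> * exp (\<kappa> * 0))) {0..t}"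
    using t by (intro fundamental_theorem_of_calculus) auto
  have "norm (integral {0..t} (\<lambda>s. integral {x-(t-s)..x+(t-s)} (\<lambda>y. F (y, s)))) \<le> integral {0..t} ?E"
  proof (rule integral_norm_bound_integral)
    fix s assume s: "s \<in> {0..t}"
    have "norm (integral {x-(t-s)..x+(t-s)} (\<lambda>y. F (y, s))) \<le> (B * exp (\<kappa> * s)) * ((x+(t-s)) - (x-(t-s)))"
    proof (rule integral_bound[OF _ continuous_on_horizontal_slice[OF assms(1-3) s]])
      show "norm (F (y, s)) \<le> B * exp (\<kappa> * s)" if "y \<in> {x-(t-s)..x+(t-s)}" for y
        using s that by (intro F cone_subset_char_triangle[OF assms(1,3)]) auto
    qed (use s in auto)
    also have "\<dots> \<le> (B * exp (\<kappa> * s)) * (2 * b)"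
      using s t assms by (intro mult_left_mono) auto
    finally show "norm (integral {x-(t-s)..x+(t-s)} (\<lambda>y. F (y, s))) \<le> ?E s"
      by (simp add: mult_ac)
  next
    show "(\<lambda>s. integral {x-(t-s)..x+(t-s)} (\<lambda>y. F (y, s))) integrable_on {0..t}"
      by (intro integrable_continuous_interval continuous_on_cone_integral[OF assms(1-3)])
    show "?E integrable_on {0..t}"
      using E by blast
  qed
  also have "\<dots> = 2 * b * B / \<kappa> * exp (\<kappa> * t) - 2 * b * B / \<kappa> * exp (\<kappa> * 0)"
    by (rule integral_unique[OF E])
  also have "\<dots> \<le> 2 * (b * B / \<kappa> * exp (\<kappa> * t))"
    using divide_nonneg_pos[of "2 * b * B" \<kappa>] assms(1,4,5) by (simp add: mult_ac)
  finally show ?thesis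
    by (simp add: duhamel_def norm_divide mult_ac)
qed

lemma mild_solutionD:
  assumes "mild_solution b q g h u"
  shows "continuous_on {-b..b} h" "continuous_on (char_triangle b) u"
    and "p \<in> char_triangle b \<Longrightarrow> u p = dalembert g h p - duhamel (\<lambda>(y, s). q y * u (y, s)) p"
  using assms unfolding mild_solution_def by blast+

lemma mild_solution_add:
  assumes "b > 0" "continuous_on {-b..b} q"
    and u: "mild_solution b q g h u" and u': "mild_solution b q g' h' u'"
  shows "mild_solution b q (\<lambda>x. g x + g' x) (\<lambda>x. h x + h' x) (\<lambda>p. u p + u' p)"
  unfolding mild_solution_def
proof (intro conjI ballI)
  fix p assume p: "p \<in> char_triangle b"
  obtain x t where xt: "p = (x, t)" by (cases p)
  have sub: "{x-t..x+t} \<subseteq> {-b..b}"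
    using p assms(1) by (auto simp: mem_char_triangle xt)
  have "integral {x-t..x+t} (\<lambda>x. h x + h' x) = integral {x-t..x+t} h + integral {x-t..x+t} h'"
    using mild_solutionD(1)[OF u] mild_solutionD(1)[OF u'] continuous_on_subset[OF _ sub]
    by (intro integral_add integrable_continuous_interval) auto
  then have "dalembert (\<lambda>x. g x + g' x) (\<lambda>x. h x + h' x) p = dalembert g h p + dalembert g' h' p"
    by (simp add: dalembert_def xt field_simps)
  moreover have "duhamel (\<lambda>(y, s). q y * (u (y, s) + u' (y, s))) p =
      duhamel (\<lambda>(y, s). q y * u (y, s)) p + duhamel (\<lambda>(y, s). q y * u' (y, s)) p"
    using duhamel_add[OF assms(1) continuous_on_potential_times[OF assms(1,2) mild_solutionD(2)[OF u]]
        continuous_on_potential_times[OF assms(1,2) mild_solutionD(2)[OF u']] p]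
    by (simp add: case_prod_unfold ring_distribs)
  ultimately show "u p + u' p = dalembert (\<lambda>x. g x + g' x) (\<lambda>x. h x + h' x) p
      - duhamel (\<lambda>(y, s). q y * (u (y, s) + u' (y, s))) p"
    using mild_solutionD(3)[OF u p] mild_solutionD(3)[OF u' p] by simp
qed (intro continuous_intros mild_solutionD(1,2)[OF u] mild_solutionD(1,2)[OF u'])+

lemma mild_solution_cmult:
  assumes u: "mild_solution b q g h u"
  shows "mild_solution b q (\<lambda>x. c * g x) (\<lambda>x. c * h x) (\<lambda>p. c * u p)"
  unfolding mild_solution_def
proof (intro conjI ballI)
  fix p assume p: "p \<in> char_triangle b"
  have "dalembert (\<lambda>x. c * g x) (\<lambda>x. c * h x) p = c * dalembert g h p"
    by (cases p) (simp add: dalembert_def algebra_simps)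
  moreover have "duhamel (\<lambda>(y, s). q y * (c * u (y, s))) p = c * duhamel (\<lambda>(y, s). q y * u (y, s)) p"
    unfolding duhamel_cmult[symmetric] by (simp add: case_prod_unfold mult_ac)
  ultimately show "c * u p = dalembert (\<lambda>x. c * g x) (\<lambda>x. c * h x) p
      - duhamel (\<lambda>(y, s). q y * (c * u (y, s))) p"
    using mild_solutionD(3)[OF u p] by (simp add: right_diff_distrib)
qed (intro continuous_intros mild_solutionD(1,2)[OF u])+

lemma mild_solution_diff:
  assumes "b > 0" "continuous_on {-b..b} q" "mild_solution b q g h u" "mild_solution b q g' h' u'"
  shows "mild_solution b q (\<lambda>x. g x - g' x) (\<lambda>x. h x - h' x) (\<lambda>p. u p - u' p)"
  using mild_solution_add[OF assms(1-3) mild_solution_cmult[OF assms(4), of "-1"]] by simp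

lemma norm_dalembert_le:
  assumes "b > 0" "continuous_on {-b..b} h" "(x, t) \<in> char_triangle b"
    and "\<And>x. x \<in> {-b..b} \<Longrightarrow> norm (g x) \<le> M" "\<And>x. x \<in> {-b..b} \<Longrightarrow> norm (h x) \<le> N"
  shows "norm (dalembert g h (x, t)) \<le> M + b * N"
proof -
  have t: "0 \<le> t" "t \<le> b" and sub: "{x-t..x+t} \<subseteq> {-b..b}"
    using assms by (auto simp: mem_char_triangle)
  have "N \<ge> 0"
    using order_trans[OF norm_ge_zero assms(5)[of 0]] assms(1) by simp
  have "norm (integral {x-t..x+t} h) \<le> N * ((x+t) - (x-t))"
    using assms t sub by (intro integral_bound) (auto intro: continuous_on_subset)
  also have "\<dots> \<le> 2 * (b * N)"
    using mult_right_mono[OF t(2) \<open>N \<ge> 0\<close>] by (simp add: algebra_simps)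
  finally have "norm (integral {x-t..x+t} h / 2) \<le> b * N"
    by (simp add: norm_divide)
  moreover have "norm (g (x + t)) \<le> M" "norm (g (x - t)) \<le> M"
    using assms t sub by auto
  then have "norm ((g (x + t) + g (x - t)) / 2) \<le> M"
    using norm_triangle_ineq[of "g (x + t)" "g (x - t)"] by (simp add: norm_divide)
  ultimately show ?thesis
    unfolding dalembert_def by (simp add: norm_triangle_le)
qed

lemma bounded_potential:
  assumes "continuous_on {-b..b::real} (q :: real \<Rightarrow> complex)"
  obtains Q where "Q > 0" "\<And>x. x \<in> {-b..b} \<Longrightarrow> norm (q x) \<le> Q"
  using compact_imp_bounded[OF compact_continuous_image[OF assms]] unfolding bounded_pos by auto

text \<open>A Gronwall estimate.  At a point where \<open>|u| exp(-\<kappa>t)\<close> is maximal, the Duhamel term is at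
  most half of the maximum if \<open>\<kappa>\<close> is chosen as twice \<open>b\<close> times a bound of \<open>q\<close>; so the data must
  account for the other half.  The constant depends on \<open>b\<close> and \<open>q\<close> only, which turns uniform
  convergence of data into uniform convergence of solutions.\<close>

lemma mild_solution_bound:
  assumes "b > 0" "continuous_on {-b..b} q"
  obtains C where "C > 0" "\<And>g h u M N p. mild_solution b q g h u \<Longrightarrow>
      (\<And>x. x \<in> {-b..b} \<Longrightarrow> norm (g x) \<le> M) \<Longrightarrow> (\<And>x. x \<in> {-b..b} \<Longrightarrow> norm (h x) \<le> N) \<Longrightarrow>
      p \<in> char_triangle b \<Longrightarrow> norm (u p) \<le> C * (M + b * N)"
proof -
  obtain Q where Q: "Q > 0" "\<And>x. x \<in> {-b..b} \<Longrightarrow> norm (q x) \<le> Q"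
    using bounded_potential[OF assms(2)] by blast
  define \<kappa> where "\<kappa> = 2 * b * Q"
  have \<kappa>: "\<kappa> > 0" using assms Q by (simp add: \<kappa>_def)
  show thesis
  proof (rule that[of "2 * exp (\<kappa> * b)"])
    fix g h u M N p
    assume u: "mild_solution b q g h u" and g: "\<And>x. x \<in> {-b..b} \<Longrightarrow> norm (g x) \<le> M"
      and h: "\<And>x. x \<in> {-b..b} \<Longrightarrow> norm (h x) \<le> N" and p: "p \<in> char_triangle b"
    have contu: "continuous_on (char_triangle b) u" and conth: "continuous_on {-b..b} h"
      using mild_solutionD(1,2)[OF u] by auto
    have "continuous_on (char_triangle b) (\<lambda>p. norm (u p) * exp (- \<kappa> * snd p))"
      by (intro continuous_intros contu)
    then obtain m where m: "m \<in> char_triangle b"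
      "\<And>p. p \<in> char_triangle b \<Longrightarrow> norm (u p) * exp (- \<kappa> * snd p) \<le> norm (u m) * exp (- \<kappa> * snd m)"
      using continuous_attains_sup[OF compact_char_triangle, of b "\<lambda>p. norm (u p) * exp (- \<kappa> * snd p)"] p
      by blast
    obtain x t where xt: "m = (x, t)" by (cases m)
    \<comment> \<open>The weighted maximum, attained at \<open>(x,t)\<close>.\<close>
    define W where "W = norm (u (x, t)) * exp (- \<kappa> * t)"
    have W: "norm (u (y, s)) \<le> W * exp (\<kappa> * s)" if "(y, s) \<in> char_triangle b" for y s
      using m(2)[OF that] by (simp add: W_def xt exp_minus field_simps)
    have "W \<ge> 0" by (simp add: W_def)
    have "norm (duhamel (\<lambda>(y, s). q y * u (y, s)) (x, t)) \<le> b * (Q * W) / \<kappa> * exp (\<kappa> * t)"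
    proof (rule norm_duhamel_le[OF assms(1) continuous_on_potential_times[OF assms contu] _ \<kappa>])
      fix y s assume ys: "(y, s) \<in> char_triangle b"
      then have "norm (q y) \<le> Q"
        using Q(2) fst_char_triangle[OF assms(1)] by blast
      then show "norm (case (y, s) of (y, s) \<Rightarrow> q y * u (y, s)) \<le> Q * W * exp (\<kappa> * s)"
        using mult_mono[OF _ W[OF ys]] Q(1) by (simp add: norm_mult mult.assoc)
    qed (use m xt Q \<open>W \<ge> 0\<close> in auto)
    also have "b * (Q * W) / \<kappa> = W / 2"
      using assms Q by (simp add: \<kappa>_def field_simps)
    finally have "norm (duhamel (\<lambda>(y, s). q y * u (y, s)) (x, t)) \<le> W / 2 * exp (\<kappa> * t)" .
    moreover have "norm (dalembert g h (x, t)) \<le> M + b * N"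
      using m xt norm_dalembert_le[OF assms(1) conth _ g h] by simp
    moreover have "u (x, t) = dalembert g h (x, t) - duhamel (\<lambda>(y, s). q y * u (y, s)) (x, t)"
      using mild_solutionD(3)[OF u] m xt by blast
    ultimately have "norm (u (x, t)) \<le> (M + b * N) + W / 2 * exp (\<kappa> * t)"
      using norm_triangle_ineq4[of "dalembert g h (x, t)"] by (smt (verit))
    moreover have "norm (u (x, t)) = W * exp (\<kappa> * t)"
      by (simp add: W_def exp_minus)
    moreover have "W * 1 \<le> W * exp (\<kappa> * t)"
      using m xt assms \<kappa> \<open>W \<ge> 0\<close> by (intro mult_left_mono) (auto simp: mem_char_triangle)
    ultimately have "W \<le> 2 * (M + b * N)"
      by simp
    obtain y s where ys: "p = (y, s)" by (cases p)
    have "norm (u p) \<le> W * exp (\<kappa> * s)"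
      using W p ys by simp
    also have "\<dots> \<le> W * exp (\<kappa> * b)"
      using p ys assms \<kappa> \<open>W \<ge> 0\<close> by (intro mult_left_mono) (auto simp: mem_char_triangle)
    also have "\<dots> \<le> 2 * (M + b * N) * exp (\<kappa> * b)"
      using \<open>W \<le> 2 * (M + b * N)\<close> by (intro mult_right_mono) auto
    finally show "norm (u p) \<le> 2 * exp (\<kappa> * b) * (M + b * N)"
      by (simp only: mult_ac)
  qed auto
qed

lemma duhamel_LIMSEQ:
  assumes "b > 0" "continuous_on {-b..b} q" "\<And>n. continuous_on (char_triangle b) (u n)"
    and lim: "uniform_limit (char_triangle b) u v sequentially" and p: "p \<in> char_triangle b"
  shows "(\<lambda>n. duhamel (\<lambda>(y, s). q y * u n (y, s)) p) \<longlonglongrightarrow> duhamel (\<lambda>(y, s). q y * v (y, s)) p"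
proof (rule LIMSEQ_I)
  obtain Q where Q: "Q > 0" "\<And>x. x \<in> {-b..b} \<Longrightarrow> norm (q x) \<le> Q"
    using bounded_potential[OF assms(2)] by blast
  have v: "continuous_on (char_triangle b) v"
    by (rule uniform_limit_theorem[OF _ lim]) (use assms in auto)
  obtain x t where xt: "p = (x, t)" by (cases p)
  fix e :: real assume "e > 0"
  define d where "d = e / (2 * (b * Q * exp t))"
  have "d > 0" using \<open>e > 0\<close> assms Q by (simp add: d_def)
  then obtain n0 where n0: "\<And>n p. n \<ge> n0 \<Longrightarrow> p \<in> char_triangle b \<Longrightarrow> norm (u n p - v p) < d"
    using lim unfolding uniform_limit_iff eventually_sequentially dist_norm by metis
  have "norm (duhamel (\<lambda>(y, s). q y * u n (y, s)) p - duhamel (\<lambda>(y, s). q y * v (y, s)) p) < e" if "n \<ge> n0" for n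
  proof -
    have contd: "continuous_on (char_triangle b) (\<lambda>p. u n p - v p)"
      by (intro continuous_intros v assms)
    have "duhamel (\<lambda>(y, s). q y * u n (y, s)) p =
        duhamel (\<lambda>(y, s). q y * (u n (y, s) - v (y, s))) p + duhamel (\<lambda>(y, s). q y * v (y, s)) p"
      using duhamel_add[OF assms(1) continuous_on_potential_times[OF assms(1,2) contd]
        continuous_on_potential_times[OF assms(1,2) v] p]
      by (simp add: case_prod_unfold ring_distribs)
    moreover have "norm (duhamel (\<lambda>(y, s). q y * (u n (y, s) - v (y, s))) (x, t)) \<le> b * (Q * d) / 1 * exp (1 * t)"
    proof (rule norm_duhamel_le[OF assms(1) continuous_on_potential_times[OF assms(1,2) contd]])
      fix y s assume ys: "(y, s) \<in> char_triangle b"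
      then have "norm (q y) \<le> Q" "0 \<le> s"
        using Q(2) fst_char_triangle[OF assms(1)] mem_char_triangle[OF assms(1)] by blast+
      then have "norm (q y * (u n (y, s) - v (y, s))) \<le> Q * d"
        unfolding norm_mult using n0[OF that ys] Q(1) by (intro mult_mono) auto
      also have "Q * d * 1 \<le> Q * d * exp (1 * s)"
        using Q(1) \<open>d > 0\<close> \<open>0 \<le> s\<close> by (intro mult_left_mono) auto
      finally show "norm (case (y, s) of (y, s) \<Rightarrow> q y * (u n (y, s) - v (y, s))) \<le> Q * d * exp (1 * s)"
        by simp
    qed (use p xt Q \<open>d > 0\<close> in auto)
    moreover have "b * (Q * d) * exp t = e / 2"
      using assms Q by (simp add: d_def field_simps)
    ultimately show ?thesis
      using \<open>e > 0\<close> by (simp add: xt)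
  qed
  then show "\<exists>n0. \<forall>n\<ge>n0. norm (duhamel (\<lambda>(y, s). q y * u n (y, s)) p - duhamel (\<lambda>(y, s). q y * v (y, s)) p) < e"
    by blast
qed

text \<open>The integral equation contains no derivatives, so it survives a uniform limit.\<close>

lemma mild_solution_uniform_limit:
  assumes "b > 0" "continuous_on {-b..b} q" "\<And>n. mild_solution b q (g n) (h n) (u n)"
    and g: "uniform_limit {-b..b} g g' sequentially" and h: "uniform_limit {-b..b} h h' sequentially"
    and u: "uniform_limit (char_triangle b) u u' sequentially"
  shows "mild_solution b q g' h' u'"
proof -
  have cont: "continuous_on {-b..b} (h n)" "continuous_on (char_triangle b) (u n)" for n
    using mild_solutionD(1,2)[OF assms(3)] by auto
  have "u' p = dalembert g' h' p - duhamel (\<lambda>(y, s). q y * u' (y, s)) p" if p: "p \<in> char_triangle b" for p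
  proof -
    obtain x t where xt: "p = (x, t)" by (cases p)
    have t: "0 \<le> t" and sub: "{x-t..x+t} \<subseteq> {-b..b}"
      using p assms(1) by (auto simp: mem_char_triangle xt)
    have "uniform_limit {x-t..x+t} h h' sequentially"
      using h sub by (rule uniform_limit_on_subset)
    then have "(\<lambda>n. integral {x-t..x+t} (h n)) \<longlonglongrightarrow> integral {x-t..x+t} h'"
    proof (rule uniform_limit_integral[OF _ continuous_on_subset[OF cont(1) sub] sequentially_bot])
      fix I J
      assume I: "\<And>n. (h n has_integral I n) {x-t..x+t}" and J: "(h' has_integral J) {x-t..x+t}"
        and "I \<longlonglongrightarrow> J"
      then show ?thesis
        using integral_unique[OF I] integral_unique[OF J] by simp
    qed
    moreover have "(\<lambda>n. g n (x + t)) \<longlonglongrightarrow> g' (x + t)" "(\<lambda>n. g n (x - t)) \<longlonglongrightarrow> g' (x - t)"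
      using sub t by (auto intro!: tendsto_uniform_limitI[OF g])
    ultimately have "(\<lambda>n. dalembert (g n) (h n) p) \<longlonglongrightarrow> dalembert g' h' p"
      unfolding dalembert_def xt by (auto intro!: tendsto_intros)
    then have "(\<lambda>n. dalembert (g n) (h n) p - duhamel (\<lambda>(y, s). q y * u n (y, s)) p)
        \<longlonglongrightarrow> dalembert g' h' p - duhamel (\<lambda>(y, s). q y * u' (y, s)) p"
      by (intro tendsto_diff duhamel_LIMSEQ[OF assms(1,2) cont(2) u p])
    moreover have "(\<lambda>n. u n p) \<longlonglongrightarrow> u' p"
      using tendsto_uniform_limitI[OF u p] .
    moreover have "dalembert (g n) (h n) p - duhamel (\<lambda>(y, s). q y * u n (y, s)) p = u n p" for n
      using mild_solutionD(3)[OF assms(3) p] by simp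
    ultimately show ?thesis
      using LIMSEQ_unique by fastforce
  qed
  moreover have "continuous_on {-b..b} h'"
    by (rule uniform_limit_theorem[OF _ h]) (use cont in auto)
  moreover have "continuous_on (char_triangle b) u'"
    by (rule uniform_limit_theorem[OF _ u]) (use cont in auto)
  ultimately show ?thesis
    unfolding mild_solution_def by blast
qed

lemma mild_solution_unique:
  assumes "b > 0" "continuous_on {-b..b} q" "mild_solution b q g h u" "mild_solution b q g h v"
    and p: "p \<in> char_triangle b"
  shows "u p = v p"
proof -
  obtain C where C: "\<And>g h u M N p. mild_solution b q g h u \<Longrightarrow>
      (\<And>x. x \<in> {-b..b} \<Longrightarrow> norm (g x) \<le> M) \<Longrightarrow> (\<And>x. x \<in> {-b..b} \<Longrightarrow> norm (h x) \<le> N) \<Longrightarrow>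
      p \<in> char_triangle b \<Longrightarrow> norm (u p) \<le> C * (M + b * N)"
    using mild_solution_bound[OF assms(1,2)] by metis
  have "norm (u p - v p) \<le> C * (0 + b * 0)"
    by (rule C[OF mild_solution_diff[OF assms(1-4)] _ _ p]) auto
  then show ?thesis by simp
qed

text \<open>By linearity the estimate applies to differences, so that solutions whose data form Cauchy
  sequences form a Cauchy sequence themselves.  This also
  yields the existence of a solution for the limit data.\<close>

lemma mild_solutions_converge:
  assumes "b > 0" "continuous_on {-b..b} q" "\<And>n. mild_solution b q (g n) (h n) (u n)"
    and g: "uniform_limit {-b..b} g g' sequentially" and h: "uniform_limit {-b..b} h h' sequentially"
  obtains u' where "uniform_limit (char_triangle b) u u' sequentially" "mild_solution b q g' h' u'"
proof -
  obtain C where "C > 0" and C: "\<And>g h u M N p. mild_solution b q g h u \<Longrightarrow>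
      (\<And>x. x \<in> {-b..b} \<Longrightarrow> norm (g x) \<le> M) \<Longrightarrow> (\<And>x. x \<in> {-b..b} \<Longrightarrow> norm (h x) \<le> N) \<Longrightarrow>
      p \<in> char_triangle b \<Longrightarrow> norm (u p) \<le> C * (M + b * N)"
    using mild_solution_bound[OF assms(1,2)] by metis
  have "uniformly_Cauchy_on (char_triangle b) u"
  proof (rule uniformly_Cauchy_onI)
    fix e :: real assume "e > 0"
    define d where "d = e / (2 * (C * (1 + b)))"
    have "d > 0" using \<open>e > 0\<close> \<open>C > 0\<close> assms(1) by (simp add: d_def)
    have "uniformly_Cauchy_on {-b..b} g" "uniformly_Cauchy_on {-b..b} h"
      using g h by (auto intro!: uniformly_convergent_Cauchy uniformly_convergentI)
    then obtain K L where K: "\<And>x m n. x \<in> {-b..b} \<Longrightarrow> m \<ge> K \<Longrightarrow> n \<ge> K \<Longrightarrow> dist (g m x) (g n x) < d"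
      and L: "\<And>x m n. x \<in> {-b..b} \<Longrightarrow> m \<ge> L \<Longrightarrow> n \<ge> L \<Longrightarrow> dist (h m x) (h n x) < d"
      using \<open>d > 0\<close> unfolding uniformly_Cauchy_on_def by metis
    have "dist (u m p) (u n p) < e"
      if p: "p \<in> char_triangle b" and "m \<ge> max K L" "n \<ge> max K L" for p m n
    proof -
      have "norm (u m p - u n p) \<le> C * (d + b * d)"
        using that(2,3) K L by (intro C[OF mild_solution_diff[OF assms(1,2,3,3)] _ _ p])
          (auto simp: dist_norm intro!: less_imp_le)
      also have "\<dots> = e / 2"
      proof -
        have "C * (1 + b) \<noteq> 0" using \<open>C > 0\<close> assms(1) by simp
        then have "d * (C * (1 + b)) = e / 2" by (simp add: d_def)
        then show ?thesis by (simp add: algebra_simps)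
      qed
      finally show ?thesis
        using \<open>e > 0\<close> by (simp add: dist_norm)
    qed
    then show "\<exists>M. \<forall>p\<in>char_triangle b. \<forall>m\<ge>M. \<forall>n\<ge>M. dist (u m p) (u n p) < e"
      by blast
  qed
  then obtain u' where u': "uniform_limit (char_triangle b) u u' sequentially"
    using Cauchy_uniformly_convergent unfolding uniformly_convergent_on_def by blast
  then show thesis
    using that mild_solution_uniform_limit[OF assms u'] by blast
qed

section \<open>Regularity of mild solutions\<close>

text \<open>The integral of \<open>F\<close> along the characteristic through \<open>(x,t)\<close> on which \<open>x + \<sigma>t\<close> is constant,
  from the line \<open>t = 0\<close> up to \<open>(x,t)\<close>; the two families of characteristics are \<open>\<sigma> = 1\<close> and
  \<open>\<sigma> = -1\<close>.\<close>

definition char_integral :: "real \<Rightarrow> (real \<times> real \<Rightarrow> complex) \<Rightarrow> real \<times> real \<Rightarrow> complex" where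
  "char_integral \<sigma> F = (\<lambda>(x, t). prim (\<lambda>s. F (x + \<sigma> * (t - s), s)) t)"

definition hprim :: "(real \<times> real \<Rightarrow> complex) \<Rightarrow> real \<times> real \<Rightarrow> complex" where
  "hprim F = (\<lambda>(y, s). prim (\<lambda>y. F (y, s)) y)"

text \<open>The Duhamel integral on the whole plane.  Its inner integral over a horizontal slice is
  written as the difference of the values of a primitive at the two end points of the slice, and as
  the height varies these end points run along the two characteristics through the apex.\<close>

definition global_duhamel :: "(real \<times> real \<Rightarrow> complex) \<Rightarrow> real \<times> real \<Rightarrow> complex" where
  "global_duhamel F = (\<lambda>p. (char_integral 1 (hprim F) p - char_integral (-1) (hprim F) p) / 2)"

lemma continuous_on_UNIV_compose:
  assumes "continuous_on UNIV F" "continuous_on S f"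
  shows "continuous_on S (\<lambda>p. F (f p))"
  using continuous_on_compose2[OF assms] by simp

text \<open>In the characteristic coordinate \<open>z = x + \<sigma>t\<close> the integrand is \<open>G(z - \<sigma>s, s)\<close>.  The point
  \<open>(x,t)\<close> enters through \<open>z\<close> and through the upper limit only, and \<open>z\<close> sits in the first argument.\<close>

lemma char_integral_C1_of_horizontal_derivative:
  assumes G: "continuous_on UNIV G" and F: "continuous_on UNIV F"
    and G': "\<And>y s. ((\<lambda>y. G (y, s)) has_vector_derivative F (y, s)) (at y)"
  shows "C1_partials UNIV (char_integral \<sigma> G) (char_integral \<sigma> F)
    (\<lambda>p. G p + of_real \<sigma> * char_integral \<sigma> F p)"
proof -
  have "C1_partials UNIV (\<lambda>(a, z). prim (\<lambda>s. G (z - \<sigma> * s, s)) a) (\<lambda>(a, z). G (z - \<sigma> * a, a))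
      (\<lambda>(a, z). prim (\<lambda>s. F (z - \<sigma> * s, s)) a)"
  proof (rule C1_partials_prim)
    show "continuous_on UNIV (\<lambda>(s, z). G (z - \<sigma> * s, s))" "continuous_on UNIV (\<lambda>(s, z). F (z - \<sigma> * s, s))"
      unfolding case_prod_unfold
      by (intro continuous_on_UNIV_compose[OF G] continuous_on_UNIV_compose[OF F] continuous_intros)+
    show "((\<lambda>z. G (z - \<sigma> * s, s)) has_vector_derivative F (z - \<sigma> * s, s)) (at z)" for s z
      using has_vector_derivative_compose_affine[of "\<lambda>y. G (y, s)" "F (z - \<sigma> * s, s)" "- \<sigma> * s" 1 z UNIV UNIV]
        G'[of s "z - \<sigma> * s"] by simp
  qed
  from C1_partials_compose_linear[OF this, of 0 1 1 \<sigma>] show ?thesis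
    by (simp add: char_integral_def case_prod_unfold algebra_simps scaleR_conv_of_real)
qed

text \<open>Now the same characteristic is parametrised by its first coordinate \<open>y = z - \<sigma>s\<close>, so that
  \<open>z\<close> moves to the second argument of \<open>F(y, \<sigma>(z - y))\<close>.  This is how a potential that is merely
  continuous can be handled: \<open>F = qu\<close> is differentiable in \<open>t\<close> as soon as \<open>u\<close> is.\<close>

lemma char_integral_C1_of_vertical_derivative:
  assumes F: "continuous_on UNIV F" and F': "continuous_on UNIV F'"
    and d: "\<And>y s. ((\<lambda>s. F (y, s)) has_vector_derivative F' (y, s)) (at s)"
    and \<sigma>: "\<sigma> * \<sigma> = (1::real)"
  obtains E where "C1_partials UNIV (char_integral \<sigma> F) (\<lambda>p. of_real \<sigma> * (E p - F p)) E"
proof -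
  define \<Phi> where "\<Phi> = (\<lambda>(a, z). prim (\<lambda>y. F (y, \<sigma> * (z - y))) a)"
  define \<Phi>' where "\<Phi>' = (\<lambda>(a, z). prim (\<lambda>y. \<sigma> *\<^sub>R F' (y, \<sigma> * (z - y))) a)"
  have slice: "continuous_on UNIV (\<lambda>y. F (y, \<sigma> * (z - y)))" for z
    by (intro continuous_on_UNIV_compose[OF F] continuous_intros)
  have \<Phi>: "C1_partials UNIV \<Phi> (\<lambda>(a, z). F (a, \<sigma> * (z - a))) \<Phi>'"
    unfolding \<Phi>_def \<Phi>'_def
  proof (rule C1_partials_prim)
    show "continuous_on UNIV (\<lambda>(y, z). F (y, \<sigma> * (z - y)))"
      "continuous_on UNIV (\<lambda>(y, z). \<sigma> *\<^sub>R F' (y, \<sigma> * (z - y)))"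
      unfolding case_prod_unfold
      by (intro continuous_on_UNIV_compose[OF F] continuous_on_UNIV_compose[OF F'] continuous_intros)+
    show "((\<lambda>z. F (y, \<sigma> * (z - y))) has_vector_derivative \<sigma> *\<^sub>R F' (y, \<sigma> * (z - y))) (at z)" for y z
      using has_vector_derivative_compose_affine[of "\<lambda>s. F (y, s)" "F' (y, \<sigma> * (z - y))" "- \<sigma> * y" \<sigma> z UNIV UNIV]
        d[of y "\<sigma> * (z - y)"] by (simp add: algebra_simps)
  qed
  define E where "E = (\<lambda>(x, t). F (x + \<sigma> * t, 0) + \<Phi>' (x + \<sigma> * t, x + \<sigma> * t) - \<Phi>' (x, x + \<sigma> * t))"
  have "char_integral \<sigma> F (x, t) = of_real \<sigma> * (\<Phi> (x + \<sigma> * t, x + \<sigma> * t) - \<Phi> (x, x + \<sigma> * t))" for x t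
  proof -
    have "\<sigma> \<noteq> 0" "inverse \<sigma> = \<sigma>"
      using \<sigma> by (auto intro: inverse_unique)
    have "(\<lambda>s. F (x + \<sigma> * (t - s), s)) =
        (\<lambda>s. (\<lambda>y. F (y, \<sigma> * (x + \<sigma> * t - y))) (x + \<sigma> * t + (- \<sigma>) * s))"
      using \<sigma> by (auto simp: algebra_simps simp flip: mult.assoc)
    then show ?thesis
      using prim_affine[OF slice, of "- \<sigma>" "x + \<sigma> * t" "x + \<sigma> * t" t] \<open>\<sigma> \<noteq> 0\<close> \<open>inverse \<sigma> = \<sigma>\<close>
      by (simp add: char_integral_def \<Phi>_def scaleR_conv_of_real algebra_simps)
  qed
  then have "char_integral \<sigma> F = (\<lambda>p. of_real \<sigma> * ((\<lambda>(x, t). \<Phi> (1 * x + \<sigma> * t, 1 * x + \<sigma> * t)) p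
      - (\<lambda>(x, t). \<Phi> (1 * x + 0 * t, 1 * x + \<sigma> * t)) p))"
    by auto
  moreover have "C1_partials UNIV \<dots> (\<lambda>p. of_real \<sigma> * (E p - F p)) E"
    by (rule C1_partials_cong[OF C1_partials_cmult[OF C1_partials_diff[OF
            C1_partials_compose_linear[OF \<Phi>] C1_partials_compose_linear[OF \<Phi>]]]])
      (use \<sigma> in \<open>auto simp: E_def scaleR_conv_of_real algebra_simps simp flip: mult.assoc of_real_mult\<close>)
  ultimately show thesis
    using that by simp
qed

lemma continuous_on_hprim:
  assumes "continuous_on UNIV F"
  shows "continuous_on UNIV (hprim F)"
  using continuous_on_prim[of "\<lambda>y s. F (y, s)"] assms by (simp add: hprim_def case_prod_unfold)

lemma hprim_has_derivative:
  assumes "continuous_on UNIV F"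
  shows "((\<lambda>y. hprim F (y, s)) has_vector_derivative F (y, s)) (at y)"
  unfolding hprim_def case_prod_conv
  by (intro prim_has_vector_derivative continuous_on_UNIV_compose[OF assms] continuous_intros)

lemma global_duhamel_C1:
  assumes F: "continuous_on UNIV F"
  shows "C1_partials UNIV (global_duhamel F)
    (\<lambda>p. (char_integral 1 F p - char_integral (-1) F p) / 2)
    (\<lambda>p. (char_integral 1 F p + char_integral (-1) F p) / 2)"
proof -
  note C1 = char_integral_C1_of_horizontal_derivative[OF continuous_on_hprim[OF F] F hprim_has_derivative[OF F]]
  show ?thesis
    using C1_partials_cmult[OF C1_partials_diff[OF C1[of 1] C1[of "-1"]], of "1/2"]
    by (simp add: global_duhamel_def)
qed

text \<open>The derivatives of the characteristic integrals in \<open>t\<close> contribute equally to the second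
  derivatives in \<open>x\<close> and in \<open>t\<close>; what is left of the difference is \<open>-F\<close>, one half of it from each
  of the two characteristics.\<close>

lemma global_duhamel_C2:
  assumes F: "continuous_on UNIV F" and F': "continuous_on UNIV F'"
    and d: "\<And>y s. ((\<lambda>s. F (y, s)) has_vector_derivative F' (y, s)) (at s)"
  obtains wxx wxt wtx wtt where
    "C1_partials UNIV (\<lambda>p. (char_integral 1 F p - char_integral (-1) F p) / 2) wxx wxt"
    "C1_partials UNIV (\<lambda>p. (char_integral 1 F p + char_integral (-1) F p) / 2) wtx wtt"
    "\<And>p. wxx p - wtt p = - F p"
proof -
  obtain E where E: "C1_partials UNIV (char_integral 1 F) (\<lambda>p. of_real 1 * (E p - F p)) E"
    using char_integral_C1_of_vertical_derivative[OF F F' d, of 1] by auto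
  obtain E' where E': "C1_partials UNIV (char_integral (-1) F) (\<lambda>p. of_real (-1) * (E' p - F p)) E'"
    using char_integral_C1_of_vertical_derivative[OF F F' d, of "-1"] by auto
  show thesis
  proof (rule that)
    show "C1_partials UNIV (\<lambda>p. (char_integral 1 F p - char_integral (-1) F p) / 2)
        (\<lambda>p. (E p + E' p) / 2 - F p) (\<lambda>p. (E p - E' p) / 2)"
      by (rule C1_partials_cong[OF C1_partials_cmult[OF C1_partials_diff[OF E E'], of "1/2", simplified]])
        (simp_all add: field_simps)
    show "C1_partials UNIV (\<lambda>p. (char_integral 1 F p + char_integral (-1) F p) / 2)
        (\<lambda>p. (E p - E' p) / 2) (\<lambda>p. (E p + E' p) / 2)"
      by (rule C1_partials_cong[OF C1_partials_cmult[OF C1_partials_add[OF E E'], of "1/2", simplified]])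
        (simp_all add: field_simps)
  qed simp
qed

lemma global_duhamel_eq_duhamel:
  assumes "b > 0" "continuous_on UNIV F" "\<And>p. p \<in> char_triangle b \<Longrightarrow> F p = F' p"
    and p: "p \<in> char_triangle b"
  shows "global_duhamel F p = duhamel F' p"
proof -
  obtain x t where xt: "p = (x, t)" by (cases p)
  have t: "0 \<le> t"
    using p assms(1) by (simp add: xt mem_char_triangle)
  have cont: "continuous_on UNIV (\<lambda>s. hprim F (x + \<sigma> * (t - s), s))" for \<sigma>
    by (intro continuous_on_UNIV_compose[OF continuous_on_hprim[OF assms(2)]] continuous_intros)
  have int: "(\<lambda>s. hprim F (x + \<sigma> * (t - s), s)) integrable_on {0..t}" for \<sigma>
    by (intro integrable_continuous_interval continuous_on_subset[OF cont]) auto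
  have "char_integral \<sigma> (hprim F) (x, t) = integral {0..t} (\<lambda>s. hprim F (x + \<sigma> * (t - s), s))" for \<sigma>
    using prim_diff[OF cont t, of \<sigma>] by (simp add: char_integral_def)
  then have "global_duhamel F (x, t) = (integral {0..t} (\<lambda>s. hprim F (x + 1 * (t - s), s))
      - integral {0..t} (\<lambda>s. hprim F (x + (-1) * (t - s), s))) / 2"
    by (simp add: global_duhamel_def)
  also have "\<dots> = integral {0..t} (\<lambda>s. hprim F (x + 1 * (t - s), s) - hprim F (x + (-1) * (t - s), s)) / 2"
    by (simp only: integral_diff[OF int int])
  also have "integral {0..t} (\<lambda>s. hprim F (x + 1 * (t - s), s) - hprim F (x + (-1) * (t - s), s)) =
      integral {0..t} (\<lambda>s. integral {x-(t-s)..x+(t-s)} (\<lambda>y. F' (y, s)))"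
  proof (rule integral_cong)
    fix s assume s: "s \<in> {0..t}"
    have "continuous_on UNIV (\<lambda>y. F (y, s))"
      by (intro continuous_on_UNIV_compose[OF assms(2)] continuous_intros)
    then have "prim (\<lambda>y. F (y, s)) (x + (t - s)) - prim (\<lambda>y. F (y, s)) (x - (t - s)) =
        integral {x-(t-s)..x+(t-s)} (\<lambda>y. F (y, s))"
      using s by (intro prim_diff) auto
    then have "hprim F (x + 1 * (t - s), s) - hprim F (x + (-1) * (t - s), s) =
        integral {x-(t-s)..x+(t-s)} (\<lambda>y. F (y, s))"
      by (simp only: hprim_def case_prod_conv mult_1 mult_minus_left add_uminus_conv_diff)
    also have "\<dots> = integral {x-(t-s)..x+(t-s)} (\<lambda>y. F' (y, s))"
    proof (rule integral_cong)
      show "F (y, s) = F' (y, s)" if "y \<in> {x-(t-s)..x+(t-s)}" for y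
        using s that by (intro assms(3) cone_subset_char_triangle[OF assms(1) p[unfolded xt]]) auto
    qed
    finally show "hprim F (x + 1 * (t - s), s) - hprim F (x + (-1) * (t - s), s) =
        integral {x-(t-s)..x+(t-s)} (\<lambda>y. F' (y, s))" .
  qed
  finally show ?thesis
    by (simp add: duhamel_def xt)
qed

lemma C1_partials_travelling_wave:
  assumes A: "C1_deriv UNIV A A'"
  shows "C1_partials UNIV (\<lambda>(x, t). A (x + \<sigma> * t)) (\<lambda>(x, t). A' (x + \<sigma> * t))
    (\<lambda>(x, t). of_real \<sigma> * A' (x + \<sigma> * t))"
proof (rule C1_partials_UNIV_I)
  fix x t
  have A'd: "(A has_vector_derivative A' y) (at y)" and A'c: "continuous_on UNIV A'" for y
    using A by (auto simp: C1_deriv_def)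
  show "((\<lambda>x. case (x, t) of (x, t) \<Rightarrow> A (x + \<sigma> * t)) has_vector_derivative
      (case (x, t) of (x, t) \<Rightarrow> A' (x + \<sigma> * t))) (at x)"
    using has_vector_derivative_compose_affine[of A "A' (x + \<sigma> * t)" "\<sigma> * t" 1 x UNIV UNIV] A'd
    by (simp add: add.commute)
  show "((\<lambda>t. case (x, t) of (x, t) \<Rightarrow> A (x + \<sigma> * t)) has_vector_derivative
      (case (x, t) of (x, t) \<Rightarrow> of_real \<sigma> * A' (x + \<sigma> * t))) (at t)"
    using has_vector_derivative_compose_affine[of A "A' (x + \<sigma> * t)" x \<sigma> t UNIV UNIV] A'd
    by (simp add: scaleR_conv_of_real)
  show "continuous_on UNIV (\<lambda>(x, t). A' (x + \<sigma> * t))"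
    unfolding case_prod_unfold by (intro continuous_on_UNIV_compose[OF A'c] continuous_intros)
  then show "continuous_on UNIV (\<lambda>(x, t). of_real \<sigma> * A' (x + \<sigma> * t))"
    unfolding case_prod_unfold by (intro continuous_intros)
qed

text \<open>A bootstrap.  All data are extended from the interval to the line, and the solution from the
  triangle to the plane, where the calculus above applies.  The right-hand side of the integral
  equation at a point of the triangle depends on values in the triangle only, so feeding any
  continuous extension of \<open>u\<close> into it returns a function that still equals \<open>u\<close> on the triangle but
  has one more derivative.  The first round gives \<open>C\<^sup>1\<close>, the second \<open>C\<^sup>2\<close>.\<close>

lemma mild_solution_imp_classical:
  assumes "b > 0" and q: "continuous_on {-b..b} q" and u: "mild_solution b q g h u"
    and "C2_on {-b..b} g" "C1_on {-b..b} h"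
  obtains v where "classical_solution b q g h v" "\<And>p. p \<in> char_triangle b \<Longrightarrow> v p = u p"
proof -
  have I: "-b \<le> b" using assms(1) by simp
  obtain g1 g2 where g: "C1_deriv {-b..b} g g1" "C1_deriv {-b..b} g1 g2"
    using assms(4) by (auto simp: C2_on_def)
  obtain h1 where h: "C1_deriv {-b..b} h h1"
    using assms(5) by (auto simp: C1_on_def)
  obtain G2 where G2: "continuous_on UNIV G2" "\<And>x. x \<in> {-b..b} \<Longrightarrow> G2 x = g2 x"
    using continuous_extension_interval[OF _ I] g(2) by (auto simp: C1_deriv_def)
  obtain G1 where G1: "C1_deriv UNIV G1 G2" "\<And>x. x \<in> {-b..b} \<Longrightarrow> G1 x = g1 x"
    using C1_deriv_extension[OF g(2) G2 I] by blast
  have G1c: "continuous_on UNIV G1"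
    using G1(1) unfolding C1_deriv_def
    by (meson continuous_at_imp_continuous_on has_vector_derivative_continuous UNIV_I)
  obtain G where G: "C1_deriv UNIV G G1" "\<And>x. x \<in> {-b..b} \<Longrightarrow> G x = g x"
    using C1_deriv_extension[OF g(1) G1c G1(2) I] by blast
  obtain H1 where H1: "continuous_on UNIV H1" "\<And>x. x \<in> {-b..b} \<Longrightarrow> H1 x = h1 x"
    using continuous_extension_interval[OF _ I] h by (auto simp: C1_deriv_def)
  obtain H where H: "C1_deriv UNIV H H1" "\<And>x. x \<in> {-b..b} \<Longrightarrow> H x = h x"
    using C1_deriv_extension[OF h H1 I] by blast
  have Hc: "continuous_on UNIV H"
    using H(1) unfolding C1_deriv_def
    by (meson continuous_at_imp_continuous_on has_vector_derivative_continuous UNIV_I)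
  obtain Q where Q: "continuous_on UNIV Q" "\<And>x. x \<in> {-b..b} \<Longrightarrow> Q x = q x"
    using continuous_extension_interval[OF q I] by blast

  \<comment> \<open>D'Alembert's expression as a sum of two travelling waves with profiles \<open>A\<close> and \<open>B\<close>.\<close>
  define A B where "A = (\<lambda>x. (G x + prim H x) / 2)" and "B = (\<lambda>x. (G x - prim H x) / 2)"
  define A1 B1 where "A1 = (\<lambda>x. (G1 x + H x) / 2)" and "B1 = (\<lambda>x. (G1 x - H x) / 2)"
  define A2 B2 where "A2 = (\<lambda>x. (G2 x + H1 x) / 2)" and "B2 = (\<lambda>x. (G2 x - H1 x) / 2)"
  have AB: "C1_deriv UNIV A A1" "C1_deriv UNIV B B1" "C1_deriv UNIV A1 A2" "C1_deriv UNIV B1 B2"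
    using G G1 H Hc G1c G2(1) H1(1) prim_has_vector_derivative[OF Hc]
    unfolding A_def B_def A1_def B1_def A2_def B2_def C1_deriv_def
    by (auto intro!: continuous_intros has_vector_derivative_divide has_vector_derivative_add has_vector_derivative_diff)
  define D where "D = (\<lambda>p. (\<lambda>(x, t). A (x + 1 * t)) p + (\<lambda>(x, t). B (x + (-1) * t)) p)"
  define Dx where "Dx = (\<lambda>p. (\<lambda>(x, t). A1 (x + 1 * t)) p + (\<lambda>(x, t). B1 (x + (-1) * t)) p)"
  define Dt where "Dt = (\<lambda>p. (\<lambda>(x, t). of_real 1 * A1 (x + 1 * t)) p + (\<lambda>(x, t). of_real (-1) * B1 (x + (-1) * t)) p)"
  define Dxx where "Dxx = (\<lambda>p. (\<lambda>(x, t). A2 (x + 1 * t)) p + (\<lambda>(x, t). B2 (x + (-1) * t)) p)"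
  define Dxt where "Dxt = (\<lambda>p. (\<lambda>(x, t). A2 (x + 1 * t)) p - (\<lambda>(x, t). B2 (x + (-1) * t)) p)"
  have D: "C1_partials UNIV D Dx Dt"
    unfolding D_def Dx_def Dt_def by (intro C1_partials_add C1_partials_travelling_wave AB)
  have Dx: "C1_partials UNIV Dx Dxx Dxt"
    unfolding Dx_def
    by (rule C1_partials_cong[OF C1_partials_add[OF C1_partials_travelling_wave[OF AB(3)] C1_partials_travelling_wave[OF AB(4)]]])
      (auto simp: Dxx_def Dxt_def)
  have "Dt = (\<lambda>p. (\<lambda>(x, t). A1 (x + 1 * t)) p - (\<lambda>(x, t). B1 (x + (-1) * t)) p)"
    by (auto simp: Dt_def)
  moreover have "C1_partials UNIV \<dots> Dxt Dxx"
    by (rule C1_partials_cong[OF C1_partials_diff[OF C1_partials_travelling_wave[OF AB(3)] C1_partials_travelling_wave[OF AB(4)]]])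
      (auto simp: Dxx_def Dxt_def)
  ultimately have Dt: "C1_partials UNIV Dt Dxt Dxx"
    by simp
  have D_eq: "D p = dalembert g h p" if p: "p \<in> char_triangle b" for p
  proof -
    obtain x t where xt: "p = (x, t)" by (cases p)
    have t: "0 \<le> t" and sub: "{x-t..x+t} \<subseteq> {-b..b}"
      using p assms(1) by (auto simp: mem_char_triangle xt)
    have "prim H (x + t) - prim H (x - t) = integral {x-t..x+t} H"
      using t by (intro prim_diff Hc) auto
    also have "\<dots> = integral {x-t..x+t} h"
      using sub H(2) by (intro integral_cong) blast
    finally have "integral {x-t..x+t} h = prim H (x + t) - prim H (x - t)" ..
    moreover have "G (x + t) = g (x + t)" "G (x - t) = g (x - t)"
      using sub t by (auto intro!: G(2))
    moreover have "D p = (G (x + t) + G (x - t)) / 2 + (prim H (x + t) - prim H (x - t)) / 2"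
      by (simp add: D_def A_def B_def xt add_divide_distrib diff_divide_distrib)
    ultimately show ?thesis
      by (simp add: dalembert_def xt)
  qed

  \<comment> \<open>The right-hand side of the integral equation as a map on functions on the plane.\<close>
  define V where "V = (\<lambda>w p. D p - global_duhamel (\<lambda>(y, s). Q y * w (y, s)) p)"
  have Qw: "continuous_on UNIV (\<lambda>(y, s). Q y * w (y, s))" if "continuous_on UNIV w" for w :: "real \<times> real \<Rightarrow> complex"
    unfolding case_prod_unfold
    using that by (auto intro!: continuous_intros continuous_on_UNIV_compose[OF Q(1)])
  have V_C1: "C1_partials UNIV (V w)
      (\<lambda>p. Dx p - (char_integral 1 (\<lambda>(y, s). Q y * w (y, s)) p - char_integral (-1) (\<lambda>(y, s). Q y * w (y, s)) p) / 2)
      (\<lambda>p. Dt p - (char_integral 1 (\<lambda>(y, s). Q y * w (y, s)) p + char_integral (-1) (\<lambda>(y, s). Q y * w (y, s)) p) / 2)"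
    if "continuous_on UNIV w" for w
    unfolding V_def by (intro C1_partials_diff D global_duhamel_C1 Qw that)
  have V_eq: "V w p = u p"
    if w: "continuous_on UNIV w" "\<And>p. p \<in> char_triangle b \<Longrightarrow> w p = u p" and p: "p \<in> char_triangle b" for w p
  proof -
    have "global_duhamel (\<lambda>(y, s). Q y * w (y, s)) p = duhamel (\<lambda>(y, s). q y * u (y, s)) p"
    proof (rule global_duhamel_eq_duhamel[OF assms(1) Qw[OF w(1)] _ p])
      fix p assume p: "p \<in> char_triangle b"
      then have "fst p \<in> {-b..b}"
        using fst_char_triangle[OF assms(1)] by (cases p) auto
      then show "(case p of (y, s) \<Rightarrow> Q y * w (y, s)) = (case p of (y, s) \<Rightarrow> q y * u (y, s))"
        using Q(2) w(2)[OF p] by (simp add: case_prod_unfold)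
    qed
    then show ?thesis
      using mild_solutionD(3)[OF u p] D_eq[OF p] by (simp add: V_def)
  qed

  define u0 where "u0 = (\<lambda>p. u (closest_point (char_triangle b) p))"
  have tri: "convex (char_triangle b)" "closed (char_triangle b)" "char_triangle b \<noteq> {}"
    using compact_imp_closed[OF compact_char_triangle] by (auto simp: char_triangle_def)
  have u0: "continuous_on UNIV u0" "\<And>p. p \<in> char_triangle b \<Longrightarrow> u0 p = u p"
    unfolding u0_def using tri closest_point_in_set[OF tri(2,3)]
    by (auto simp: closest_point_self intro!: continuous_on_compose2[OF mild_solutionD(2)[OF u]] continuous_on_closest_point)
  define w where "w = V u0"
  define v where "v = V w"
  have w: "continuous_on UNIV w" "\<And>p. p \<in> char_triangle b \<Longrightarrow> w p = u p"
    unfolding w_def using V_eq[OF u0] C1_partials_continuous[OF V_C1[OF u0(1)]] by auto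
  have v: "p \<in> char_triangle b \<Longrightarrow> v p = u p" for p
    unfolding v_def using V_eq[OF w] by blast
  define F where "F = (\<lambda>(y, s). Q y * w (y, s))"
  obtain wx wt where w_C1: "C1_partials UNIV w wx wt"
    using V_C1[OF u0(1)] unfolding w_def by blast
  have F: "continuous_on UNIV F" "continuous_on UNIV (\<lambda>(y, s). Q y * wt (y, s))"
    unfolding F_def using w(1) w_C1 by (auto intro!: Qw simp: C1_partials_def)
  have F': "((\<lambda>s. F (y, s)) has_vector_derivative (case (y, s) of (y, s) \<Rightarrow> Q y * wt (y, s))) (at s)" for y s
    using has_vector_derivative_mult_right[OF C1_partials_along_line[OF w_C1, of s UNIV y 0 0 1], of "Q y"]
    by (simp add: F_def)
  obtain wxx wxt wtx wtt where W:
    "C1_partials UNIV (\<lambda>p. (char_integral 1 F p - char_integral (-1) F p) / 2) wxx wxt"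
    "C1_partials UNIV (\<lambda>p. (char_integral 1 F p + char_integral (-1) F p) / 2) wtx wtt"
    "\<And>p. wxx p - wtt p = - F p"
    using global_duhamel_C2[OF F F'] by blast
  define vx where "vx = (\<lambda>p. Dx p - (char_integral 1 F p - char_integral (-1) F p) / 2)"
  define vt where "vt = (\<lambda>p. Dt p - (char_integral 1 F p + char_integral (-1) F p) / 2)"
  have "classical_solution b q g h v"
    unfolding classical_solution_def
  proof (intro exI conjI)
    show "C1_partials (char_triangle b) v vx vt"
      using V_C1[OF w(1)] unfolding v_def vx_def vt_def F_def by (rule C1_partials_subset) simp
    show "C1_partials (char_triangle b) vx (\<lambda>p. Dxx p - wxx p) (\<lambda>p. Dxt p - wxt p)"
      unfolding vx_def by (rule C1_partials_subset[OF C1_partials_diff[OF Dx W(1)]]) simp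
    show "C1_partials (char_triangle b) vt (\<lambda>p. Dxt p - wtx p) (\<lambda>p. Dxx p - wtt p)"
      unfolding vt_def by (rule C1_partials_subset[OF C1_partials_diff[OF Dt W(2)]]) simp
    show "\<forall>(x, t)\<in>char_triangle b. Dxx (x, t) - wxx (x, t) - (Dxx (x, t) - wtt (x, t)) - q x * v (x, t) = 0"
    proof clarify
      fix x t assume xt: "(x, t) \<in> char_triangle b"
      then have "Q x = q x" "w (x, t) = v (x, t)"
        using Q(2) fst_char_triangle[OF assms(1)] w(2) v by (blast, simp)
      then show "Dxx (x, t) - wxx (x, t) - (Dxx (x, t) - wtt (x, t)) - q x * v (x, t) = 0"
        using W(3)[of "(x, t)"] by (simp add: F_def algebra_simps)
    qed
    show "\<forall>x\<in>{-b..b}. v (x, 0) = g x \<and> vt (x, 0) = h x"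
    proof
      fix x assume x: "x \<in> {-b..b}"
      then have "(x, 0) \<in> char_triangle b"
        using assms(1) by (auto simp: mem_char_triangle)
      then have "v (x, 0) = g x"
        using v mild_solutionD(3)[OF u] by (simp add: dalembert_def duhamel_def)
      moreover have "vt (x, 0) = h x"
        using H(2)[OF x] by (simp add: vt_def Dt_def A1_def B1_def char_integral_def field_simps)
      ultimately show "v (x, 0) = g x \<and> vt (x, 0) = h x" ..
    qed
  qed
  with v show thesis
    using that by blast
qed

section \<open>Classical solutions are mild\<close>

text \<open>Let \<open>A(s)\<close> be the integral of \<open>v\<^sub>t\<close> over the slice at height \<open>s\<close> of the backward triangle
  with apex \<open>(x,t)\<close>, plus the values of \<open>v\<close> at the two end points of the slice.  At \<open>s = t\<close> the
  slice shrinks to the apex and \<open>A(t) = 2 v(x,t)\<close>, while \<open>A(0)\<close> is twice d'Alembert's expression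
  in the data.  In \<open>A'(s)\<close> the terms at the moving end points combine to the increment of \<open>-v\<^sub>x\<close>
  over the slice, so that \<open>A'(s)\<close> is the integral of \<open>v\<^sub>t\<^sub>t - v\<^sub>x\<^sub>x = -qv\<close> over the slice.\<close>

lemma classical_imp_mild_solution:
  assumes "b > 0" and q: "continuous_on {-b..b} q" and v: "classical_solution b q g h v"
  shows "mild_solution b q g h v"
proof -
  obtain vx vt vxx vxt vtx vtt where
    dv: "C1_partials (char_triangle b) v vx vt" and dvx: "C1_partials (char_triangle b) vx vxx vxt"
    and dvt: "C1_partials (char_triangle b) vt vtx vtt"
    and pde: "\<forall>(x, t)\<in>char_triangle b. vxx (x, t) - vtt (x, t) - q x * v (x, t) = 0"
    and data: "\<forall>x\<in>{-b..b}. v (x, 0) = g x \<and> vt (x, 0) = h x"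
    using v unfolding classical_solution_def by blast
  have cont: "continuous_on (char_triangle b) v" "continuous_on (char_triangle b) vt"
    "continuous_on (char_triangle b) vtx" "continuous_on (char_triangle b) vtt"
    using C1_partials_continuous[OF dv] dv dvt by (auto simp: C1_partials_def)
  have qv: "continuous_on (char_triangle b) (\<lambda>(y, s). q y * v (y, s))"
    by (rule continuous_on_potential_times[OF assms(1) q cont(1)])
  have base: "(x, 0) \<in> char_triangle b" if "x \<in> {-b..b}" for x
    using that assms(1) by (auto simp: mem_char_triangle)
  have "continuous_on {-b..b} (\<lambda>x. vt (x, 0))"
    by (rule continuous_on_compose2[OF cont(2)]) (use base in \<open>auto intro!: continuous_intros\<close>)
  then have conth: "continuous_on {-b..b} h"
    using data by (subst continuous_on_cong[OF refl, of _ _ "\<lambda>x. vt (x, 0)"]) auto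
  have "v p = dalembert g h p - duhamel (\<lambda>(y, s). q y * v (y, s)) p" if p: "p \<in> char_triangle b" for p
  proof -
    obtain x t where xt: "p = (x, t)" by (cases p)
    have xtT: "(x, t) \<in> char_triangle b" using p xt by simp
    have t: "0 \<le> t" and sub: "{x-t..x+t} \<subseteq> {-b..b}"
      using p assms(1) by (auto simp: mem_char_triangle xt)
    have cone: "(x + (t - s) * r, s) \<in> char_triangle b" if "s \<in> {0..t}" "r \<in> {-1..1}" for s r
      using cone_subset_char_triangle'[OF assms(1) xtT that] .
    have slice: "continuous_on {-1..1} (\<lambda>r. w (x + (t - s) * r, s))"
      if "continuous_on (char_triangle b) w" "s \<in> {0..t}" for w :: "real \<times> real \<Rightarrow> complex" and s
      by (rule continuous_on_compose2[OF that(1)]) (use cone that(2) in \<open>auto intro!: continuous_intros\<close>)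
    \<comment> \<open>The slice at height \<open>s\<close> is \<open>x + (t - s) r\<close> with \<open>r\<close> in the fixed interval \<open>[-1,1]\<close>.\<close>
    define I where "I = (\<lambda>s. integral {-1..1} (\<lambda>r. vt (x + (t - s) * r, s)))"
    define I' where "I' = (\<lambda>s. integral {-1..1} (\<lambda>r. (- r) *\<^sub>R vtx (x + (t - s) * r, s) + vtt (x + (t - s) * r, s)))"
    define K where "K = (\<lambda>s. integral {x-(t-s)..x+(t-s)} (\<lambda>y. q y * v (y, s)))"
    define A where "A = (\<lambda>s. (t - s) *\<^sub>R I s + v (x + (t - s), s) + v (x - (t - s), s))"
    have dI: "(I has_vector_derivative I' s) (at s within {0..t})" if s: "s \<in> {0..t}" for s
    proof -
      have "((\<lambda>s. integral (cbox (-1) 1) (\<lambda>r. vt (x + (t - s) * r, s))) has_vector_derivative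
          integral (cbox (-1) 1) (\<lambda>r. (- r) *\<^sub>R vtx (x + (t - s) * r, s) + vtt (x + (t - s) * r, s)))
          (at s within {0..t})"
      proof (rule leibniz_rule_vector_derivative)
        fix s r assume sr: "s \<in> {0..t}" "r \<in> cbox (-1) (1::real)"
        have "((\<lambda>s. vt ((x + t * r) + (- r) * s, 0 + 1 * s)) has_vector_derivative
            (- r) *\<^sub>R vtx ((x + t * r) + (- r) * s, 0 + 1 * s) + 1 *\<^sub>R vtt ((x + t * r) + (- r) * s, 0 + 1 * s))
            (at s within {0..t})"
          by (rule C1_partials_along_line[OF dvt sr(1)]) (use cone[of _ r] sr(2) in \<open>auto simp: algebra_simps\<close>)
        then show "((\<lambda>s. vt (x + (t - s) * r, s)) has_vector_derivative
            (- r) *\<^sub>R vtx (x + (t - s) * r, s) + vtt (x + (t - s) * r, s)) (at s within {0..t})"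
          by (simp add: algebra_simps)
      next
        show "(\<lambda>r. vt (x + (t - s) * r, s)) integrable_on cbox (-1) 1" if "s \<in> {0..t}" for s
          unfolding box_real by (intro integrable_continuous_interval slice cont that)
      next
        have param: "continuous_on ({0..t} \<times> {-1..1}) (\<lambda>p. w (x + (t - fst p) * snd p, fst p))"
          if "continuous_on (char_triangle b) w" for w :: "real \<times> real \<Rightarrow> complex"
          by (rule continuous_on_compose2[OF that]) (use cone in \<open>auto intro!: continuous_intros\<close>)
        show "continuous_on ({0..t} \<times> cbox (-1) 1)
            (\<lambda>(s, r). (- r) *\<^sub>R vtx (x + (t - s) * r, s) + vtt (x + (t - s) * r, s))"
          unfolding case_prod_unfold box_real by (intro continuous_intros param[OF cont(3)] param[OF cont(4)])
      qed (use s in auto)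
      then show ?thesis
        by (simp add: I_def I'_def)
    qed
    have dA: "(A has_vector_derivative - K s) (at s within {0..t})" if s: "s \<in> {0..t}" for s
    proof -
      define \<tau> where "\<tau> = t - s"
      let ?P = "\<lambda>r. (x + \<tau> * r, s)"
      have P: "?P r \<in> char_triangle b" if "r \<in> {-1..1}" for r
        using cone[OF s that] by (simp add: \<tau>_def)
      have "((\<lambda>s. v ((x + t) + (-1) * s, 0 + 1 * s)) has_vector_derivative
          (-1) *\<^sub>R vx ((x + t) + (-1) * s, 0 + 1 * s) + 1 *\<^sub>R vt ((x + t) + (-1) * s, 0 + 1 * s)) (at s within {0..t})"
        by (rule C1_partials_along_line[OF dv s]) (use cone[of _ 1] in \<open>auto simp: algebra_simps\<close>)
      then have right: "((\<lambda>s. v (x + (t - s), s)) has_vector_derivative - vx (?P 1) + vt (?P 1)) (at s within {0..t})"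
        by (simp add: \<tau>_def algebra_simps)
      have "((\<lambda>s. v ((x - t) + 1 * s, 0 + 1 * s)) has_vector_derivative
          1 *\<^sub>R vx ((x - t) + 1 * s, 0 + 1 * s) + 1 *\<^sub>R vt ((x - t) + 1 * s, 0 + 1 * s)) (at s within {0..t})"
        by (rule C1_partials_along_line[OF dv s]) (use cone[of _ "-1"] in \<open>auto simp: algebra_simps\<close>)
      then have left: "((\<lambda>s. v (x - (t - s), s)) has_vector_derivative vx (?P (-1)) + vt (?P (-1))) (at s within {0..t})"
        by (simp add: \<tau>_def algebra_simps)
      have "((\<lambda>s. (t - s) *\<^sub>R I s) has_vector_derivative \<tau> *\<^sub>R I' s + (-1) *\<^sub>R I s) (at s within {0..t})"
        unfolding \<tau>_def
        by (rule has_vector_derivative_scaleR[OF _ dI[OF s]]) (auto intro!: derivative_eq_intros)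
      from has_vector_derivative_add[OF has_vector_derivative_add[OF this right] left]
      have dA': "(A has_vector_derivative \<tau> *\<^sub>R I' s + (-1) *\<^sub>R I s + (- vx (?P 1) + vt (?P 1))
          + (vx (?P (-1)) + vt (?P (-1)))) (at s within {0..t})"
        unfolding A_def .
      \<comment> \<open>This primitive integrates by parts the term with \<open>v\<^sub>t\<^sub>x\<close> in \<open>I'\<close>, which comes from the
        motion of the slice, and at the same time produces the integral of \<open>v\<^sub>x\<^sub>x\<close>.\<close>
      have "((\<lambda>r. r *\<^sub>R vt (?P r) - vx (?P r)) has_vector_derivative
          r *\<^sub>R (\<tau> *\<^sub>R vtx (?P r)) + 1 *\<^sub>R vt (?P r) - \<tau> *\<^sub>R vxx (?P r)) (at r within {-1..1})"
        if r: "r \<in> {-1..1}" for r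
      proof -
        have "((\<lambda>r. w (?P r)) has_vector_derivative \<tau> *\<^sub>R wx (?P r)) (at r within {-1..1})"
          if "C1_partials (char_triangle b) w wx wt" for w wx wt
          using C1_partials_along_line[OF that r, of x \<tau> s 0] P by simp
        from this[OF dvt] this[OF dvx] show ?thesis
          by (intro has_vector_derivative_diff has_vector_derivative_scaleR) auto
      qed
      from fundamental_theorem_of_calculus[OF _ this]
      have ibp: "((\<lambda>r. r *\<^sub>R (\<tau> *\<^sub>R vtx (?P r)) + 1 *\<^sub>R vt (?P r) - \<tau> *\<^sub>R vxx (?P r)) has_integral
          (vt (?P 1) - vx (?P 1) - (- vt (?P (-1)) - vx (?P (-1))))) {-1..1}"
        by simp
      have cI': "((\<lambda>r. (- r) *\<^sub>R vtx (?P r) + vtt (?P r)) has_integral I' s) {-1..1}"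
        unfolding I'_def \<tau>_def
        by (intro integrable_integral integrable_continuous_interval continuous_intros slice cont s)
      have cI: "((\<lambda>r. vt (?P r)) has_integral I s) {-1..1}"
        unfolding I_def \<tau>_def by (intro integrable_integral integrable_continuous_interval slice cont s)
      have "((\<lambda>r. (\<tau> *\<^sub>R ((- r) *\<^sub>R vtx (?P r) + vtt (?P r)) - vt (?P r))
          + (r *\<^sub>R (\<tau> *\<^sub>R vtx (?P r)) + 1 *\<^sub>R vt (?P r) - \<tau> *\<^sub>R vxx (?P r))) has_integral
          (\<tau> *\<^sub>R I' s - I s) + (vt (?P 1) - vx (?P 1) - (- vt (?P (-1)) - vx (?P (-1))))) {-1..1}"
        by (intro has_integral_add has_integral_diff has_integral_cmul cI' cI ibp)
      moreover have "(\<tau> *\<^sub>R ((- r) *\<^sub>R vtx (?P r) + vtt (?P r)) - vt (?P r))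
          + (r *\<^sub>R (\<tau> *\<^sub>R vtx (?P r)) + 1 *\<^sub>R vt (?P r) - \<tau> *\<^sub>R vxx (?P r)) =
          - (\<tau> *\<^sub>R (q (x + \<tau> * r) * v (?P r)))" if r: "r \<in> {-1..1}" for r
      proof -
        have "vxx (?P r) = vtt (?P r) + q (x + \<tau> * r) * v (?P r)"
          using pde P[OF r] by (auto simp: algebra_simps)
        then show ?thesis
          by (simp add: algebra_simps)
      qed
      ultimately have "((\<lambda>r. - (\<tau> *\<^sub>R (q (x + \<tau> * r) * v (?P r)))) has_integral
          (\<tau> *\<^sub>R I' s - I s) + (vt (?P 1) - vx (?P 1) - (- vt (?P (-1)) - vx (?P (-1))))) {-1..1}"
        by (rule has_integral_eq[rotated]) blast
      from integral_unique[OF this]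
      have "(\<tau> *\<^sub>R I' s - I s) + (vt (?P 1) - vx (?P 1) - (- vt (?P (-1)) - vx (?P (-1)))) =
          - (\<tau> *\<^sub>R integral {-1..1} (\<lambda>r. q (x + \<tau> * r) * v (?P r)))"
        by simp
      also have "\<tau> *\<^sub>R integral {-1..1} (\<lambda>r. q (x + \<tau> * r) * v (?P r)) = K s"
        using integral_centred_interval[OF continuous_on_horizontal_slice[OF assms(1) qv xtT s]] s
        by (simp add: K_def \<tau>_def)
      finally have "\<tau> *\<^sub>R I' s + (-1) *\<^sub>R I s + (- vx (?P 1) + vt (?P 1)) + (vx (?P (-1)) + vt (?P (-1))) = - K s"
        by (simp add: algebra_simps)
      with dA' show ?thesis by simp
    qed
    have "((\<lambda>s. - K s) has_integral A t - A 0) {0..t}"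
      by (rule fundamental_theorem_of_calculus[OF t dA])
    from integral_unique[OF this] have "A t - A 0 = - integral {0..t} K"
      by simp
    moreover have "A t = 2 * v (x, t)"
      by (simp add: A_def)
    moreover have "A 0 = integral {x-t..x+t} h + g (x + t) + g (x - t)"
    proof -
      have "A 0 = integral {x-t..x+t} (\<lambda>y. vt (y, 0)) + v (x + t, 0) + v (x - t, 0)"
        using integral_centred_interval[OF continuous_on_horizontal_slice[OF assms(1) cont(2) xtT, of 0]] t
        by (simp add: A_def I_def)
      also have "integral {x-t..x+t} (\<lambda>y. vt (y, 0)) = integral {x-t..x+t} h"
        using data sub by (intro integral_cong) blast
      finally show ?thesis
        using data sub t by auto
    qed
    ultimately have "2 * v (x, t) = integral {x-t..x+t} h + g (x + t) + g (x - t) - integral {0..t} K"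
      by (simp add: algebra_simps)
    then have "v (x, t) = (integral {x-t..x+t} h + g (x + t) + g (x - t) - integral {0..t} K) / 2"
      by (simp add: mult.commute)
    then show ?thesis
      by (simp add: xt dalembert_def duhamel_def K_def add_divide_distrib diff_divide_distrib)
  qed
  with conth cont(1) show ?thesis
    unfolding mild_solution_def by blast
qed

section \<open>Formal powers and wave polynomials\<close>

text \<open>The two interlaced families of formal powers: \<open>\<phi>\<^sub>k\<close> is \<open>f\<close> times \<open>phi_power\<close>, and \<open>dual_power\<close>
  takes the other family for each parity.  Up to a factor \<open>k f\<^sup>-\<^sup>2\<close> or \<open>k f\<^sup>2\<close>, differentiation
  lowers the index by one and swaps the two, which removes the case distinction on parity.\<close>

definition phi_power :: "(real \<Rightarrow> complex) \<Rightarrow> nat \<Rightarrow> real \<Rightarrow> complex" where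
  "phi_power f k = (if odd k then Xplain f k else Xtilde f k)"

definition dual_power :: "(real \<Rightarrow> complex) \<Rightarrow> nat \<Rightarrow> real \<Rightarrow> complex" where
  "dual_power f k = (if odd k then Xtilde f k else Xplain f k)"

lemma phi_eq_phi_power: "phi f k x = f x * phi_power f k x"
  by (simp add: phi_def phi_power_def)

lemma has_vector_derivative_LBINT:
  fixes w :: "real \<Rightarrow> complex"
  assumes "continuous_on {-b..b} w" "x \<in> {-b..b}"
  shows "((\<lambda>x. c * (LBINT s=0..x. w s)) has_vector_derivative c * w x) (at x within {-b..b})"
proof (rule has_vector_derivative_mult_right)
  show "((\<lambda>x. LBINT s=0..x. w s) has_vector_derivative w x) (at x within {-b..b})"
    using interval_integral_FTC2[of "-b" 0 b w x] assms by (auto simp: zero_ereal_def)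
qed

lemma formal_powers_derivative:
  assumes "continuous_on {-b..b} f" "\<forall>x\<in>{-b..b}. f x \<noteq> 0"
  shows "continuous_on {-b..b} (phi_power f k) \<and> continuous_on {-b..b} (dual_power f k) \<and>
    (\<forall>x\<in>{-b..b}.
      (phi_power f k has_vector_derivative of_nat k * dual_power f (k - 1) x / (f x)\<^sup>2) (at x within {-b..b}) \<and>
      (dual_power f k has_vector_derivative of_nat k * phi_power f (k - 1) x * (f x)\<^sup>2) (at x within {-b..b}))"
proof (induction k)
  case 0
  then show ?case
    by (auto simp: phi_power_def dual_power_def)
next
  case (Suc k)
  have p: "phi_power f (Suc k) = (\<lambda>x. of_nat (Suc k) * (LBINT s=0..x. dual_power f k s * inverse ((f s)\<^sup>2)))"
    and d: "dual_power f (Suc k) = (\<lambda>x. of_nat (Suc k) * (LBINT s=0..x. phi_power f k s * (f s)\<^sup>2))"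
    by (auto simp: phi_power_def dual_power_def simp del: of_nat_Suc)
  have "continuous_on {-b..b} (\<lambda>s. dual_power f k s * inverse ((f s)\<^sup>2))"
    "continuous_on {-b..b} (\<lambda>s. phi_power f k s * (f s)\<^sup>2)"
    using Suc assms by (auto intro!: continuous_intros)
  note der = has_vector_derivative_LBINT[OF this(1), where c = "of_nat (Suc k)", folded p]
    has_vector_derivative_LBINT[OF this(2), where c = "of_nat (Suc k)", folded d]
  have "continuous_on {-b..b} (phi_power f (Suc k))" "continuous_on {-b..b} (dual_power f (Suc k))"
    unfolding continuous_on_eq_continuous_within
    using der has_vector_derivative_continuous by blast+
  then show ?case
    using der by (simp add: divide_inverse mult.assoc del: of_nat_Suc)
qed

text \<open>\<open>\<phi>\<^sub>k'' - q \<phi>\<^sub>k = k(k-1) \<phi>\<^sub>k\<^sub>-\<^sub>2\<close>, as for the powers of \<open>x\<close>, which are the case \<open>f = 1\<close>.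
  In \<open>\<phi>\<^sub>k' = f' Y\<^sub>k + k Z\<^sub>k\<^sub>-\<^sub>1 / f\<close> with the two formal powers \<open>Y\<close> and \<open>Z\<close>, the terms with \<open>f'\<close>
  cancel upon differentiation.\<close>

lemma phi_C2:
  assumes f: "C2_ode_solution {-b..b} q f" "\<forall>x\<in>{-b..b}. f x \<noteq> 0"
  obtains \<phi>' where "C1_deriv {-b..b} (phi f k) \<phi>'"
    "C1_deriv {-b..b} \<phi>' (\<lambda>x. q x * phi f k x + of_nat (k * (k - 1)) * phi f (k - 2) x)"
proof -
  obtain f' f'' where f': "C1_deriv {-b..b} f f'" and f'': "C1_deriv {-b..b} f' f''"
    and ode: "\<forall>x\<in>{-b..b}. f'' x - q x * f x = 0"
    using f(1) unfolding C2_ode_solution_def by blast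
  have contf: "continuous_on {-b..b} f"
    using f' unfolding C1_deriv_def continuous_on_eq_continuous_within
    by (meson has_vector_derivative_continuous)
  let ?Y = "phi_power f" and ?Z = "dual_power f"
  have YZ: "continuous_on {-b..b} (?Y k)" "continuous_on {-b..b} (?Z k)" for k
    using formal_powers_derivative[OF contf f(2), of k] by auto
  define \<phi>' where "\<phi>' = (\<lambda>x. f' x * ?Y k x + of_nat k * ?Z (k - 1) x / f x)"
  show thesis
  proof (rule that)
    show "C1_deriv {-b..b} (phi f k) \<phi>'"
      unfolding C1_deriv_def
    proof (intro conjI ballI)
      show "continuous_on {-b..b} \<phi>'"
        unfolding \<phi>'_def using f' f(2) contf by (auto simp: C1_deriv_def intro!: continuous_intros YZ)
      fix x assume x: "x \<in> {-b..b}"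
      have "((\<lambda>x. f x * ?Y k x) has_vector_derivative
          f x * (of_nat k * ?Z (k - 1) x / (f x)\<^sup>2) + f' x * ?Y k x) (at x within {-b..b})"
        using f' x formal_powers_derivative[OF contf f(2), of k]
        by (intro has_vector_derivative_mult) (auto simp: C1_deriv_def)
      moreover have "f x * (of_nat k * ?Z (k - 1) x / (f x)\<^sup>2) + f' x * ?Y k x = \<phi>' x"
        using f(2) x by (simp add: \<phi>'_def power2_eq_square)
      ultimately show "(phi f k has_vector_derivative \<phi>' x) (at x within {-b..b})"
        by (simp add: phi_eq_phi_power[abs_def])
    qed
    show "C1_deriv {-b..b} \<phi>' (\<lambda>x. q x * phi f k x + of_nat (k * (k - 1)) * phi f (k - 2) x)"
      unfolding C1_deriv_def
    proof (intro conjI ballI)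
      have "continuous_on {-b..b} (\<lambda>x. f'' x * ?Y k x + of_nat (k * (k - 1)) * phi f (k - 2) x)"
        unfolding phi_eq_phi_power using f'' contf by (auto simp: C1_deriv_def intro!: continuous_intros YZ)
      then show "continuous_on {-b..b} (\<lambda>x. q x * phi f k x + of_nat (k * (k - 1)) * phi f (k - 2) x)"
        by (rule continuous_on_eq) (use ode in \<open>auto simp: phi_eq_phi_power\<close>)
      fix x assume x: "x \<in> {-b..b}"
      have "f x \<noteq> 0" using f(2) x by blast
      have df: "(f has_vector_derivative f' x) (at x within {-b..b})"
        "(f' has_vector_derivative f'' x) (at x within {-b..b})"
        using f' f'' x by (auto simp: C1_deriv_def)
      have dY: "(?Y k has_vector_derivative of_nat k * ?Z (k - 1) x / (f x)\<^sup>2) (at x within {-b..b})"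
        and dZ: "(?Z (k - 1) has_vector_derivative of_nat (k - 1) * ?Y (k - 1 - 1) x * (f x)\<^sup>2) (at x within {-b..b})"
        using formal_powers_derivative[OF contf f(2)] x by blast+
      have dinv: "((\<lambda>x. inverse (f x)) has_vector_derivative - (inverse (f x) * f' x * inverse (f x))) (at x within {-b..b})"
      proof -
        have "((\<lambda>x. inverse (f x)) has_derivative (\<lambda>d. - (inverse (f x) * (d *\<^sub>R f' x) * inverse (f x)))) (at x within {-b..b})"
          by (rule Deriv.has_derivative_inverse[OF _ df(1)[unfolded has_vector_derivative_def]]) fact
        then show ?thesis
          unfolding has_vector_derivative_def by (rule has_derivative_eq_rhs) simp
      qed
      have "(\<phi>' has_vector_derivative (f' x * (of_nat k * ?Z (k - 1) x / (f x)\<^sup>2) + f'' x * ?Y k x)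
          + of_nat k * (?Z (k - 1) x * (- (inverse (f x) * f' x * inverse (f x)))
            + of_nat (k - 1) * ?Y (k - 1 - 1) x * (f x)\<^sup>2 * inverse (f x))) (at x within {-b..b})"
        unfolding \<phi>'_def divide_inverse[of _ "f _"] mult.assoc[of "of_nat k"]
        by (intro has_vector_derivative_add has_vector_derivative_mult has_vector_derivative_mult_right
            df dY dZ dinv)
      moreover have "(f' x * (of_nat k * ?Z (k - 1) x / (f x)\<^sup>2) + f'' x * ?Y k x)
          + of_nat k * (?Z (k - 1) x * (- (inverse (f x) * f' x * inverse (f x)))
            + of_nat (k - 1) * ?Y (k - 1 - 1) x * (f x)\<^sup>2 * inverse (f x)) =
          q x * phi f k x + of_nat (k * (k - 1)) * phi f (k - 2) x"
      proof -
        have "f'' x = q x * f x" using ode x by simp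
        moreover have "k - 1 - 1 = k - 2" by simp
        ultimately show ?thesis
          using \<open>f x \<noteq> 0\<close> by (simp add: phi_eq_phi_power divide_simps power2_eq_square) (simp add: algebra_simps)
      qed
      ultimately show "(\<phi>' has_vector_derivative q x * phi f k x + of_nat (k * (k - 1)) * phi f (k - 2) x)
          (at x within {-b..b})"
        by simp
    qed
  qed
qed

lemma C1_partials_times_power:
  assumes "b > 0" and \<phi>: "C1_deriv {-b..b} \<phi> \<phi>'"
  shows "C1_partials (char_triangle b) (\<lambda>(x, t). \<phi> x * of_real t ^ k)
    (\<lambda>(x, t). \<phi>' x * of_real t ^ k) (\<lambda>(x, t). \<phi> x * (of_nat k * of_real t ^ (k - 1)))"
proof -
  have fst: "fst ` char_triangle b \<subseteq> {-b..b}"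
    using fst_char_triangle[OF assms(1)] by force
  have "continuous_on {-b..b} \<phi>'" "continuous_on {-b..b} \<phi>"
    using \<phi> has_vector_derivative_continuous
    unfolding C1_deriv_def continuous_on_eq_continuous_within by blast+
  then have cont: "continuous_on (char_triangle b) (\<lambda>p. \<phi>' (fst p))" "continuous_on (char_triangle b) (\<lambda>p. \<phi> (fst p))"
    using fst by (auto intro!: continuous_on_compose2[where f = fst] continuous_intros)
  show ?thesis
    unfolding C1_partials_def
  proof (intro conjI ballI)
    fix p assume p: "p \<in> char_triangle b"
    obtain x t where xt: "p = (x, t)" by (cases p)
    have "(\<phi> has_derivative (\<lambda>d. d *\<^sub>R \<phi>' x)) (at (fst p) within {-b..b})"
      using \<phi> fst p unfolding xt C1_deriv_def has_vector_derivative_def by force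
    then have "(\<phi> has_derivative (\<lambda>d. d *\<^sub>R \<phi>' x)) (at (fst p) within fst ` char_triangle b)"
      using fst by (rule has_derivative_subset)
    with has_derivative_fst[OF has_derivative_ident] 
    have "((\<phi> \<circ> fst) has_derivative ((\<lambda>d. d *\<^sub>R \<phi>' x) \<circ> fst)) (at p within char_triangle b)"
      by (rule diff_chain_within)
    then have 1: "((\<lambda>p. \<phi> (fst p)) has_derivative (\<lambda>d. fst d *\<^sub>R \<phi>' x)) (at p within char_triangle b)"
      by (simp add: o_def)
    have "((\<lambda>p. complex_of_real (snd p)) has_derivative (\<lambda>d. of_real (snd d))) (at p within char_triangle b)"
      by (intro has_derivative_of_real has_derivative_snd has_derivative_ident)
    from has_derivative_power[OF this, of k]
    have 2: "((\<lambda>p. complex_of_real (snd p) ^ k) has_derivative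
        (\<lambda>d. of_nat k * of_real (snd d) * of_real t ^ (k - 1))) (at p within char_triangle b)"
      by (simp add: xt)
    have "((\<lambda>p. \<phi> (fst p) * of_real (snd p) ^ k) has_derivative
        (\<lambda>d. \<phi> x * (of_nat k * of_real (snd d) * of_real t ^ (k - 1)) + fst d *\<^sub>R \<phi>' x * of_real t ^ k))
        (at p within char_triangle b)"
      using has_derivative_mult[OF 1 2] by (simp add: xt)
    then show "((\<lambda>(x, t). \<phi> x * of_real t ^ k) has_derivative
        (\<lambda>(dx, dt). dx *\<^sub>R (case p of (x, t) \<Rightarrow> \<phi>' x * of_real t ^ k) +
          dt *\<^sub>R (case p of (x, t) \<Rightarrow> \<phi> x * (of_nat k * of_real t ^ (k - 1))))) (at p within char_triangle b)"
      unfolding case_prod_unfold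
      by (rule has_derivative_eq_rhs) (auto simp: xt scaleR_conv_of_real algebra_simps)
  qed (auto simp: case_prod_unfold intro!: continuous_intros cont)
qed

text \<open>The coefficient identity behind the wave equation: both second derivatives of the binomial sum
  lower the total degree by two, and the shift \<open>k \<mapsto> k + 2\<close>, which preserves parity, matches their
  terms.  The terms without a partner vanish.\<close>

lemma binomial_second_difference_shift:
  fixes c :: "nat \<Rightarrow> complex" and t :: complex
  shows "(\<Sum>k | even k = e \<and> k \<le> n. of_nat (n choose k) * (of_nat ((n - k) * (n - k - 1)) * c (n - k - 2)) * t ^ k) =
    (\<Sum>k | even k = e \<and> k \<le> n. of_nat (n choose k) * c (n - k) * (of_nat k * (of_nat (k - 1) * t ^ (k - 1 - 1))))"
proof (rule sum.reindex_bij_witness_not_neutral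
    [where i = "\<lambda>k. k - 2" and j = "\<lambda>k. k + 2"
      and S' = "{k. (even k = e \<and> k \<le> n) \<and> n < k + 2}" and T' = "{k. (even k = e \<and> k \<le> n) \<and> k < 2}"])
  fix k
  have "(n choose (k + 2)) * ((k + 2) * (k + 1)) = (n choose k) * ((n - k) * (n - k - 1))"
  proof -
    have a: "Suc k * (n choose Suc k) = (n - k) * (n choose k)" for k
      by (simp only: binomial_absorption binomial_absorb_comp)
    have "(n choose (k + 2)) * ((k + 2) * (k + 1)) = (Suc (Suc k) * (n choose Suc (Suc k))) * Suc k"
      by (simp add: algebra_simps)
    also have "\<dots> = (n - Suc k) * (Suc k * (n choose Suc k))"
      by (simp only: a[of "Suc k"] mult_ac)
    finally show ?thesis
      unfolding a[of k] by (simp add: mult_ac)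
  qed
  then have "of_nat ((n choose (k + 2)) * ((k + 2) * (k + 1))) * (c (n - k - 2) * t ^ k) =
      of_nat ((n choose k) * ((n - k) * (n - k - 1))) * (c (n - k - 2) * t ^ k)"
    by (rule arg_cong)
  moreover have "k + 2 - 1 = k + 1" "k + 2 - 1 - 1 = k" "n - (k + 2) = n - k - 2"
    by auto
  ultimately show "of_nat (n choose (k + 2)) * c (n - (k + 2)) * (of_nat (k + 2) * (of_nat (k + 2 - 1) * t ^ (k + 2 - 1 - 1))) =
      of_nat (n choose k) * (of_nat ((n - k) * (n - k - 1)) * c (n - k - 2)) * t ^ k"
    by (simp only: of_nat_mult mult_ac)
next
  fix k assume "k \<in> {k. (even k = e \<and> k \<le> n) \<and> n < k + 2}"
  then have "n - k = 0 \<or> n - k = 1" by auto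
  then show "of_nat (n choose k) * (of_nat ((n - k) * (n - k - 1)) * c (n - k - 2)) * t ^ k = 0"
    by auto
next
  fix k assume "k \<in> {k. (even k = e \<and> k \<le> n) \<and> k < 2}"
  then have "k = 0 \<or> k = 1" by auto
  then show "of_nat (n choose k) * c (n - k) * (of_nat k * (of_nat (k - 1) * t ^ (k - 1 - 1))) = 0"
    by auto
qed auto

text \<open>The part of \<open>(\<phi> + t)\<^sup>n\<close> that is even or odd in \<open>t\<close>, with \<open>\<phi>\<^sub>j\<close> in place of the \<open>j\<close>-th power;
  for \<open>f = 1\<close> these are \<open>((x + t)\<^sup>n \<plusminus> (x - t)\<^sup>n) / 2\<close>.\<close>

definition wave_sum :: "(real \<Rightarrow> complex) \<Rightarrow> bool \<Rightarrow> nat \<Rightarrow> real \<times> real \<Rightarrow> complex" where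
  "wave_sum f e n = (\<lambda>(x, t). \<Sum>k | even k = e \<and> k \<le> n.
    of_nat (n choose k) * phi f (n - k) x * of_real t ^ k)"

lemma wave_sum_classical_solution:
  assumes "b > 0" and f: "C2_ode_solution {-b..b} q f" "\<forall>x\<in>{-b..b}. f x \<noteq> 0"
  shows "classical_solution b q (\<lambda>x. if e then phi f n x else 0)
    (\<lambda>x. if e then 0 else of_nat n * phi f (n - 1) x) (wave_sum f e n)"
proof -
  have "\<exists>\<phi>'. C1_deriv {-b..b} (phi f k) \<phi>' \<and>
      C1_deriv {-b..b} \<phi>' (\<lambda>x. q x * phi f k x + of_nat (k * (k - 1)) * phi f (k - 2) x)" for k
    using phi_C2[OF f] by metis
  then obtain \<phi>' where \<phi>': "\<And>k. C1_deriv {-b..b} (phi f k) (\<phi>' k)"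
    "\<And>k. C1_deriv {-b..b} (\<phi>' k) (\<lambda>x. q x * phi f k x + of_nat (k * (k - 1)) * phi f (k - 2) x)"
    by metis
  let ?K = "{k. even k = e \<and> k \<le> n}"
  \<comment> \<open>Separated sums, so that differentiation acts either on the factor in \<open>x\<close> or on that in \<open>t\<close>.\<close>
  define S where "S = (\<lambda>\<phi> \<psi> p. \<Sum>k\<in>?K. of_nat (n choose k) * (\<lambda>(x::real, t). \<phi> (n - k) x * \<psi> k (of_real t :: complex)) p :: complex)"
  define T0 T1 T2 where "T0 = (\<lambda>k (t::complex). t ^ k)" and "T1 = (\<lambda>k (t::complex). of_nat k * t ^ (k - 1))"
    and "T2 = (\<lambda>k (t::complex). of_nat k * (of_nat (k - 1) * t ^ (k - 1 - 1)))"
  define \<phi>'' where "\<phi>'' = (\<lambda>k x. q x * phi f k x + of_nat (k * (k - 1)) * phi f (k - 2) x)"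
  have S0: "C1_partials (char_triangle b) (S \<phi> T0) (S \<psi> T0) (S \<phi> T1)"
    if "\<And>k. C1_deriv {-b..b} (\<phi> k) (\<psi> k)" for \<phi> \<psi>
    unfolding S_def T0_def T1_def
    by (intro C1_partials_sum C1_partials_cmult C1_partials_times_power assms(1) that)
  have S1: "C1_partials (char_triangle b) (S \<phi> T1) (S \<psi> T1) (S \<phi> T2)"
    if d: "\<And>k. C1_deriv {-b..b} (\<phi> k) (\<psi> k)" for \<phi> \<psi>
    unfolding S_def
  proof (intro C1_partials_sum C1_partials_cmult)
    fix k
    show "C1_partials (char_triangle b) (\<lambda>(x, t). \<phi> (n - k) x * T1 k (of_real t))
        (\<lambda>(x, t). \<psi> (n - k) x * T1 k (of_real t)) (\<lambda>(x, t). \<phi> (n - k) x * T2 k (of_real t))"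
      using C1_partials_cmult[OF C1_partials_times_power[OF assms(1) d, of "n - k" "k - 1"], of "of_nat k"]
      by (simp add: T1_def T2_def case_prod_unfold mult_ac)
  qed
  have wave: "wave_sum f e n = S (phi f) T0"
    by (auto simp: wave_sum_def S_def T0_def mult.assoc)
  show ?thesis
    unfolding classical_solution_def
  proof (intro exI conjI)
    show "C1_partials (char_triangle b) (wave_sum f e n) (S \<phi>' T0) (S (phi f) T1)"
      unfolding wave by (rule S0[OF \<phi>'(1)])
    show "C1_partials (char_triangle b) (S \<phi>' T0) (S \<phi>'' T0) (S \<phi>' T1)"
      unfolding \<phi>''_def by (rule S0[OF \<phi>'(2)])
    show "C1_partials (char_triangle b) (S (phi f) T1) (S \<phi>' T1) (S (phi f) T2)"
      by (rule S1[OF \<phi>'(1)])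
    show "\<forall>(x, t)\<in>char_triangle b. S \<phi>'' T0 (x, t) - S (phi f) T2 (x, t) - q x * wave_sum f e n (x, t) = 0"
    proof clarify
      fix x t
      have "S \<phi>'' T0 (x, t) = q x * S (phi f) T0 (x, t) +
          (\<Sum>k\<in>?K. of_nat (n choose k) * (of_nat ((n - k) * (n - k - 1)) * phi f (n - k - 2) x) * of_real t ^ k)"
        unfolding S_def T0_def \<phi>''_def
        by (simp add: sum_distrib_left algebra_simps flip: sum.distrib)
      also have "(\<Sum>k\<in>?K. of_nat (n choose k) * (of_nat ((n - k) * (n - k - 1)) * phi f (n - k - 2) x) * of_real t ^ k) =
          S (phi f) T2 (x, t)"
        unfolding binomial_second_difference_shift[where c = "\<lambda>k. phi f k x"] S_def T2_def
        by (simp add: mult.assoc)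
      finally show "S \<phi>'' T0 (x, t) - S (phi f) T2 (x, t) - q x * wave_sum f e n (x, t) = 0"
        by (simp add: wave)
    qed
    show "\<forall>x\<in>{-b..b}. wave_sum f e n (x, 0) = (if e then phi f n x else 0) \<and>
        S (phi f) T1 (x, 0) = (if e then 0 else of_nat n * phi f (n - 1) x)"
    proof
      fix x
      have fin: "finite ?K" by simp
      have "wave_sum f e n (x, 0) = (\<Sum>k\<in>?K. if k = 0 then phi f n x else 0)"
        unfolding wave_sum_def case_prod_conv by (intro sum.cong) auto
      also have "\<dots> = (if e then phi f n x else 0)"
        using sum.delta[OF fin, of 0 "\<lambda>_. phi f n x"] by simp
      finally have "wave_sum f e n (x, 0) = (if e then phi f n x else 0)" .
      moreover have "S (phi f) T1 (x, 0) = (\<Sum>k\<in>?K. if k = 1 then of_nat n * phi f (n - 1) x else 0)"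
        unfolding S_def T1_def case_prod_conv
      proof (intro sum.cong refl)
        show "of_nat (n choose k) * (phi f (n - k) x * (of_nat k * of_real 0 ^ (k - 1))) =
            (if k = 1 then of_nat n * phi f (n - 1) x else 0)" for k
          by (cases "k = 0"; cases "k = 1") auto
      qed
      moreover have "\<dots> = (if e then 0 else of_nat n * phi f (n - 1) x)"
        using sum.delta[OF fin, of 1 "\<lambda>_. of_nat n * phi f (n - 1) x"] by (cases n) auto
      ultimately show "wave_sum f e n (x, 0) = (if e then phi f n x else 0) \<and>
          S (phi f) T1 (x, 0) = (if e then 0 else of_nat n * phi f (n - 1) x)"
        by simp
    qed
  qed
qed

section \<open>Expansion of the solution\<close>

text \<open>For \<open>n = 0\<close> the index \<open>2 * n - 1\<close> is \<open>0\<close>, as subtraction is truncated; so the exceptional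
  \<open>u\<^sub>0\<close> is covered as well.\<close>

lemma wave_poly_odd_index: "wave_poly f (2 * n - 1) = wave_sum f True n"
proof (cases "n = 0")
  case True
  then have "{k. even k = True \<and> k \<le> n} = {0}" by auto
  then show ?thesis
    using True by (auto simp: wave_poly_def wave_sum_def phi_def fun_eq_iff)
next
  case False
  then have "(2 * n - 1 + 1) div 2 = n" "odd (2 * n - 1)" "2 * n - 1 \<noteq> 0" by auto
  then show ?thesis
    unfolding wave_poly_def wave_sum_def by simp
qed

lemma wave_poly_even_index: "wave_poly f (2 * (n + 1)) = wave_sum f False (n + 1)"
  unfolding wave_poly_def wave_sum_def by simp

definition wave_coeff :: "(nat \<Rightarrow> complex) \<Rightarrow> (nat \<Rightarrow> complex) \<Rightarrow> nat \<Rightarrow> complex" where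
  "wave_coeff \<alpha> \<beta> m = (if m = 0 \<or> odd m then \<alpha> ((m + 1) div 2) else \<beta> (m div 2 - 1) / of_nat (m div 2))"

lemma wave_coeff_simps:
  "wave_coeff \<alpha> \<beta> (2 * n - 1) = \<alpha> n"
  "wave_coeff \<alpha> \<beta> (2 * (n + 1)) = \<beta> n / of_nat (n + 1)"
  by (cases n; simp add: wave_coeff_def)+

text \<open>Among the indices \<open>m \<le> N\<close>, zero and the odd ones carry \<open>\<alpha>\<^sub>k\<close> for \<open>2k - 1 \<le> N\<close>, and the
  positive even ones carry \<open>\<beta>\<^sub>k\<close> for \<open>2(k + 1) \<le> N\<close>.  The factor \<open>1/(n + 1)\<close> in the coefficients
  cancels the one in the initial velocity \<open>(n + 1) \<phi>\<^sub>n\<close> of the wave polynomial.\<close>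

lemma mild_solution_partial_sum:
  assumes "b > 0" and q: "continuous_on {-b..b} q"
    and f: "C2_ode_solution {-b..b} q f" "\<forall>x\<in>{-b..b}. f x \<noteq> 0"
  shows "mild_solution b q (\<lambda>x. \<Sum>k<(N + 3) div 2. \<alpha> k * phi f k x) (\<lambda>x. \<Sum>k<N div 2. \<beta> k * phi f k x)
    (\<lambda>p. \<Sum>m<Suc N. wave_coeff \<alpha> \<beta> m * wave_poly f m p)"
proof (induction N)
  have odd_term: "mild_solution b q (\<lambda>x. \<alpha> n * phi f n x) (\<lambda>x. 0)
      (\<lambda>p. wave_coeff \<alpha> \<beta> (2 * n - 1) * wave_poly f (2 * n - 1) p)" for n
    using mild_solution_cmult[OF classical_imp_mild_solution[OF assms(1) q
          wave_sum_classical_solution[OF assms(1) f, of True n]], of "\<alpha> n"]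
    by (simp only: wave_poly_odd_index wave_coeff_simps if_True mult_zero_right)
  have even_term: "mild_solution b q (\<lambda>x. 0) (\<lambda>x. \<beta> n * phi f n x)
      (\<lambda>p. wave_coeff \<alpha> \<beta> (2 * (n + 1)) * wave_poly f (2 * (n + 1)) p)" for n
  proof -
    have "\<beta> n / of_nat (n + 1) * (of_nat (n + 1) * z) = \<beta> n * z" for z :: complex
      by (simp del: of_nat_add of_nat_Suc)
    then show ?thesis
      using mild_solution_cmult[OF classical_imp_mild_solution[OF assms(1) q
            wave_sum_classical_solution[OF assms(1) f, of False "n + 1"]], of "\<beta> n / of_nat (n + 1)"]
      by (simp only: wave_poly_even_index wave_coeff_simps if_False mult_zero_right add_diff_cancel_right')
  qed
  {
    case 0
    show ?case
      using odd_term[of 0] by simp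
  next
    case (Suc N)
    show ?case
    proof (cases "even N")
      case True
      then obtain n where N: "N = 2 * n" by (elim evenE)
      then have "(Suc N + 3) div 2 = Suc (n + 1)" "(N + 3) div 2 = n + 1" "Suc N div 2 = n" "N div 2 = n"
        "Suc N = 2 * (n + 1) - 1"
        by auto
      with mild_solution_add[OF assms(1) q Suc odd_term[of "n + 1"]] show ?thesis
        by (simp only: sum.lessThan_Suc add_0_right)
    next
      case False
      then obtain n where N: "N = 2 * n + 1" by (elim oddE)
      then have "(Suc N + 3) div 2 = n + 2" "(N + 3) div 2 = n + 2" "Suc N div 2 = Suc n" "N div 2 = n"
        "Suc N = 2 * (n + 1)"
        by auto
      with mild_solution_add[OF assms(1) q Suc even_term[of n]] show ?thesis
        by (simp only: sum.lessThan_Suc add_0_right)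
    qed
  }
qed

theorem proposition26:
  fixes b :: real and q f g h :: "real \<Rightarrow> complex" and \<alpha> \<beta> :: "nat \<Rightarrow> complex"
  assumes "b > 0"
    and "continuous_on {-b..b} q"
    and "C2_ode_solution {-b..b} q f"
    and "\<forall>x\<in>{-b..b}. f x \<noteq> 0"
    and "f 0 = 1"
    and "C2_on {-b..b} g"
    and "C1_on {-b..b} h"
    and "uniform_limit {-b..b} (\<lambda>N x. \<Sum>k<N. \<alpha> k * phi f k x) g sequentially"
    and "uniform_limit {-b..b} (\<lambda>N x. \<Sum>k<N. \<beta> k * phi f k x) h sequentially"
  shows "\<exists>u. classical_solution b q g h u \<and>
    (\<forall>v. classical_solution b q g h v \<longrightarrow> (\<forall>p\<in>char_triangle b. v p = u p)) \<and>
    (\<exists>a :: nat \<Rightarrow> complex.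
      a 0 = \<alpha> 0 \<and>
      (\<forall>n\<ge>1. a (2 * n - 1) = \<alpha> n) \<and>
      (\<forall>n. a (2 * (n + 1)) = \<beta> n / of_nat (n + 1)) \<and>
      uniform_limit (char_triangle b) (\<lambda>N p. \<Sum>n<N. a n * wave_poly f n p) u sequentially)"
proof -
  let ?S = "\<lambda>N p. \<Sum>n<N. wave_coeff \<alpha> \<beta> n * wave_poly f n p"
  have idx: "filterlim (\<lambda>N::nat. (N + 3) div 2) sequentially sequentially"
    "filterlim (\<lambda>N::nat. N div 2) sequentially sequentially"
    unfolding filterlim_at_top eventually_sequentially
    by (metis add_leD1 div_le_mono nonzero_mult_div_cancel_left zero_neq_numeral add.commute le_add1 order_trans)+
  obtain u where u: "uniform_limit (char_triangle b) (\<lambda>N. ?S (Suc N)) u sequentially" "mild_solution b q g h u"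
    using mild_solutions_converge[OF assms(1,2) mild_solution_partial_sum[OF assms(1-4)]
        filterlim_compose[OF assms(8) idx(1)] filterlim_compose[OF assms(9) idx(2)]]
    by metis
  obtain w where w: "classical_solution b q g h w" "\<And>p. p \<in> char_triangle b \<Longrightarrow> w p = u p"
    using mild_solution_imp_classical[OF assms(1,2) u(2) assms(6,7)] by blast
  have "v p = w p" if "classical_solution b q g h v" "p \<in> char_triangle b" for v p
    using mild_solution_unique[OF assms(1,2) classical_imp_mild_solution[OF assms(1,2) that(1)]
        classical_imp_mild_solution[OF assms(1,2) w(1)] that(2)] .
  moreover have "uniform_limit (char_triangle b) (\<lambda>N. ?S (Suc N)) w sequentially"
    using u(1) w(2) by (simp cong: uniform_limit_cong')
  then have "uniform_limit (char_triangle b) ?S w sequentially"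
    using filterlim_sequentially_Suc[of ?S] by blast
  moreover have "wave_coeff \<alpha> \<beta> 0 = \<alpha> 0"
    using wave_coeff_simps(1)[of \<alpha> \<beta> 0] by simp
  ultimately show ?thesis
    using w(1) wave_coeff_simps[of \<alpha> \<beta>] by blast
qed

end
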